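(* Fix constants $B,C>0$ and $1/2<\delta<1$, and let $B_c=1+\sqrt{1+1/C}$. For each $n\ge 1$ let $X=(X_{ij})$ be a uniformly random contingency table (matrix with nonnegative integer entries) of size $(\lfloor n^\delta\rfloor+n)\times(\lfloor n^\delta\rfloor+n)$ whose first $\lfloor n^{\delta}\rfloor$ row sums and column sums equal $\lfloor BCn\rfloor$, and whose last $n$ row sums and column sums equal $\lfloor Cn\rfloor$. Then, as $n\to\infty$, $$\mathbb{E}[X_{11}]=\Theta(1)\ \text{ if } B<B_c,\qquad\text{and}\qquad \mathbb{E}[X_{11}]=\Theta\bigl(n^{1-\delta}\bigr)\ \text{ if } B>B_c.$$
   Context: "Uniformly random" means uniform on the finite set of all nonnegative integer matrices with the prescribed row and column sums. The implied constants in $\Theta$ may depend on $\delta,B,C$. *)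

theory Defs
  imports "HOL-Probability.Probability" "HOL-Library.Landau_Symbols"
begin

text \<open>Matrices are functions of 1-based row and column indices. Entries outside the index
  range are fixed to be 0, so that each matrix is represented by exactly one function; otherwise
  the sets below would be infinite and \<open>pmf_of_set\<close> on them meaningless.\<close>

definition contingency_tables ::
  "nat \<Rightarrow> nat \<Rightarrow> (nat \<Rightarrow> nat) \<Rightarrow> (nat \<Rightarrow> nat) \<Rightarrow> (nat \<Rightarrow> nat \<Rightarrow> nat) set" where
  "contingency_tables m n r c =
    {X. (\<forall>i\<in>{1..m}. (\<Sum>j=1..n. X i j) = r i) \<and>
        (\<forall>j\<in>{1..n}. (\<Sum>i=1..m. X i j) = c j) \<and>
        (\<forall>i j. i \<notin> {1..m} \<or> j \<notin> {1..n} \<longrightarrow> X i j = 0)}"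

definition num_heavy :: "real \<Rightarrow> nat \<Rightarrow> nat" where
  "num_heavy \<delta> n = nat \<lfloor>real n powr \<delta>\<rfloor>"

definition margin :: "real \<Rightarrow> real \<Rightarrow> real \<Rightarrow> nat \<Rightarrow> nat \<Rightarrow> nat" where
  "margin B C \<delta> n i =
    (if i \<le> num_heavy \<delta> n then nat \<lfloor>B * C * real n\<rfloor> else nat \<lfloor>C * real n\<rfloor>)"

definition two_margin_tables ::
  "real \<Rightarrow> real \<Rightarrow> real \<Rightarrow> nat \<Rightarrow> (nat \<Rightarrow> nat \<Rightarrow> nat) set" where
  "two_margin_tables B C \<delta> n =
    contingency_tables (num_heavy \<delta> n + n) (num_heavy \<delta> n + n) (margin B C \<delta> n) (margin B C \<delta> n)"

definition uniform_table ::
  "real \<Rightarrow> real \<Rightarrow> real \<Rightarrow> nat \<Rightarrow> (nat \<Rightarrow> nat \<Rightarrow> nat) pmf" where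
  "uniform_table B C \<delta> n = pmf_of_set (two_margin_tables B C \<delta> n)"

definition critical_B :: "real \<Rightarrow> real" where
  "critical_B C = 1 + sqrt (1 + 1 / C)"

text \<open>The next two facts show that \<open>uniform_table\<close> is indeed the uniform distribution.\<close>

lemma finite_contingency_tables: "finite (contingency_tables m n r c)"
proof -
  define M where "M = (\<Sum>i=1..m. r i)"
  define F where "F = {f :: nat \<times> nat \<Rightarrow> nat.
    \<forall>x. (x \<in> {1..m} \<times> {1..n} \<longrightarrow> f x \<in> {..M}) \<and> (x \<notin> {1..m} \<times> {1..n} \<longrightarrow> f x = 0)}"
  have "finite F"
    unfolding F_def by (rule finite_set_of_finite_funs) auto
  moreover have "contingency_tables m n r c \<subseteq> (\<lambda>f i j. f (i, j)) ` F"
  proof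
    fix X assume X: "X \<in> contingency_tables m n r c"
    have "X i j \<le> M" if ij: "i \<in> {1..m}" "j \<in> {1..n}" for i j
    proof -
      have "X i j \<le> (\<Sum>j=1..n. X i j)"
        using ij by (intro member_le_sum) auto
      also have "\<dots> = r i"
        using X ij by (simp add: contingency_tables_def)
      also have "r i \<le> M"
        unfolding M_def using ij by (intro member_le_sum) auto
      finally show ?thesis .
    qed
    moreover have "X i j = 0" if "i \<notin> {1..m} \<or> j \<notin> {1..n}" for i j
      using X that unfolding contingency_tables_def by blast
    ultimately have "(\<lambda>(i, j). X i j) \<in> F"
      unfolding F_def by auto
    then show "X \<in> (\<lambda>f i j. f (i, j)) ` F"
      by (intro image_eqI[of _ _ "\<lambda>(i, j). X i j"]) auto
  qed
  ultimately show ?thesis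
    by (meson finite_imageI finite_subset)
qed

lemma two_margin_tables_finite_nonempty:
  "finite (two_margin_tables B C \<delta> n)" "two_margin_tables B C \<delta> n \<noteq> {}"
proof -
  show "finite (two_margin_tables B C \<delta> n)"
    by (simp add: two_margin_tables_def finite_contingency_tables)
  let ?N = "num_heavy \<delta> n + n"
  have "(\<lambda>i j. if i \<in> {1..?N} \<and> i = j then margin B C \<delta> n i else 0) \<in> two_margin_tables B C \<delta> n"
    unfolding two_margin_tables_def contingency_tables_def
    by (auto simp: sum.delta sum.delta' cong: if_cong)
  then show "two_margin_tables B C \<delta> n \<noteq> {}"
    by blast
qed

end

theory Submission
  imports Defs "HOL-Real_Asymp.Real_Asymp"
begin

text \<open>
  Write \<open>k = num_heavy \<delta> n\<close>, let \<open>u\<close> and \<open>v\<close> be the heavy and the light margin, and let \<open>S\<close> be the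
  sum of the heavy-by-heavy block of a table. Permuting heavy rows and heavy columns preserves the
  uniform distribution, so the corner entry has mean \<open>E[S] / k\<^sup>2\<close>, and the theorem is about the order of
  magnitude of \<open>E[S]\<close>: it is \<open>k\<^sup>2\<close> below the critical value and \<open>k n\<close> above it.

  The block sums of a table are determined by \<open>S\<close> and the margins: they are \<open>s\<close>, twice \<open>k u - s\<close>, and
  \<open>n v - k u + s\<close>. Let \<open>F s\<close> be the number of all nonnegative integer matrices with these block sums
  (\<open>block_count\<close>), which is a product of binomial coefficients. Clearly at most \<open>F s\<close> tables have
  \<open>S = s\<close> (\<open>card_heavy_sum_le\<close>). Conversely, \<open>F s\<close> is at most the number of all tables times a factor
  \<open>exp (O(n log n))\<close> (\<open>block_count_le\<close>): a matrix with the right block sums has one of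
  \<open>exp (O(n log n))\<close> many margins, and among the margins with a given heavy total and a given light
  total, the ones that are constant on each class admit the most tables
  (\<open>num_tables_le_split_tables\<close>). The reason for the latter is that moving one unit from a larger to
  a smaller column total never decreases the number of tables (\<open>num_tables_transfer\<close>): if the sum of
  the two columns is prescribed, then the number of ways of splitting it is a coefficient of
  a product of polynomials \<open>1 + x + \<dots> + x ^ t\<close>, and these coefficients are symmetric and unimodal.
  Hence \<open>P(S = s) \<le> exp (O(n log n)) * F s / F s'\<close> for all admissible \<open>s\<close> and \<open>s'\<close>.

  The quotient \<open>F (s + 1) / F s\<close> is explicit (\<open>block_count_Suc\<close>). For large \<open>n\<close> it is about
  \<open>(1 + k\<^sup>2 / s) * (\<beta> / (1 + \<beta>))\<^sup>2 * (1 + 1 / C)\<close>, where \<open>\<beta> = B C - s / (k n)\<close>. At \<open>\<beta> = B C\<close> the product of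
  the last two factors is below 1 if \<open>B < critical_B C\<close> and above 1 if \<open>B > critical_B C\<close>. So in the
  first case \<open>F\<close> decays geometrically beyond a constant multiple of \<open>k\<^sup>2\<close>, and in the second case it
  grows geometrically up to a constant multiple of \<open>k n\<close>; in any case it grows geometrically up to a
  small multiple of \<open>k\<^sup>2\<close>. The hypothesis \<open>\<delta> > 1/2\<close> makes \<open>k\<^sup>2\<close>, which is of order \<open>n powr (2 * \<delta>)\<close>,
  much larger than \<open>n log n\<close>, so that the geometric factors beat \<open>exp (O(n log n))\<close>
  (\<open>margin_pairs_negligible\<close>).
\<close>

section \<open>Nonnegative integer functions with a given sum\<close>

text \<open>The sum is an integer so that recursions and reflections can pass through negative
  values, for which the set is empty.\<close>

definition bounded_fillings :: "'a set \<Rightarrow> ('a \<Rightarrow> nat) \<Rightarrow> int \<Rightarrow> ('a \<Rightarrow> nat) set" where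
  "bounded_fillings A t a =
     {f. (\<forall>x\<in>A. f x \<le> t x) \<and> (\<forall>x. x \<notin> A \<longrightarrow> f x = 0) \<and> int (sum f A) = a}"

lemma finite_bounded_fillings:
  assumes "finite A"
  shows "finite (bounded_fillings A t a)"
proof (rule finite_subset)
  show "bounded_fillings A t a \<subseteq>
      {f. \<forall>x. (x \<in> A \<longrightarrow> f x \<in> {..sum t A}) \<and> (x \<notin> A \<longrightarrow> f x = 0)}"
    using assms by (auto simp: bounded_fillings_def intro: order_trans[OF _ member_le_sum])
  show "finite {f. \<forall>x. (x \<in> A \<longrightarrow> f x \<in> {..sum t A}) \<and> (x \<notin> A \<longrightarrow> f x = (0::nat))}"
    using assms by (intro finite_set_of_finite_funs) auto
qed

lemma card_bounded_fillings_insert: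
  assumes "finite A" "x \<notin> A"
  shows "card (bounded_fillings (insert x A) t a) =
         (\<Sum>y\<le>t x. card (bounded_fillings A t (a - int y)))"
proof -
  let ?U = "\<lambda>y. (\<lambda>f. f(x := y)) ` bounded_fillings A t (a - int y)"
  have sum_upd: "sum (f(x := y)) A = sum f A" for f :: "'a \<Rightarrow> nat" and y
    using assms(2) by (intro sum.cong) auto
  have upd: "f(x := y) \<in> bounded_fillings (insert x A) t a \<longleftrightarrow>
      y \<le> t x \<and> f(x := 0) \<in> bounded_fillings A t (a - int y)" for f y
  proof -
    have "(\<forall>z\<in>insert x A. (f(x := y)) z \<le> t z) \<longleftrightarrow> y \<le> t x \<and> (\<forall>z\<in>A. (f(x := 0)) z \<le> t z)"
      using assms(2) by auto
    moreover have "(\<forall>z. z \<notin> insert x A \<longrightarrow> (f(x := y)) z = 0) \<longleftrightarrow> (\<forall>z. z \<notin> A \<longrightarrow> (f(x := 0)) z = 0)"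
      by auto
    moreover have "int (sum (f(x := y)) (insert x A)) = a \<longleftrightarrow> int (sum (f(x := 0)) A) = a - int y"
      unfolding sum.insert[OF assms] sum_upd by auto
    ultimately show ?thesis
      unfolding bounded_fillings_def by blast
  qed
  have "bounded_fillings (insert x A) t a = (\<Union>y\<in>{..t x}. ?U y)"
  proof (intro equalityI subsetI)
    fix f assume f: "f \<in> bounded_fillings (insert x A) t a"
    then have "f(x := 0) \<in> bounded_fillings A t (a - int (f x))" "f x \<le> t x"
      using upd[of f "f x"] by auto
    then have "f \<in> ?U (f x)"
      by (intro rev_image_eqI[where x = "f(x := 0)"]) auto
    then show "f \<in> (\<Union>y\<in>{..t x}. ?U y)"
      using \<open>f x \<le> t x\<close> by blast
  next
    fix f assume "f \<in> (\<Union>y\<in>{..t x}. ?U y)"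
    then obtain y g where y: "y \<le> t x" and g: "g \<in> bounded_fillings A t (a - int y)"
      and f: "f = g(x := y)" by blast
    have "g(x := 0) = g" using g assms(2) by (auto simp: bounded_fillings_def)
    with y g f show "f \<in> bounded_fillings (insert x A) t a"
      using upd[of g y] by simp
  qed
  moreover have "card (\<Union>y\<in>{..t x}. ?U y) = (\<Sum>y\<in>{..t x}. card (?U y))"
  proof (rule card_UN_disjoint)
    show "\<forall>y\<in>{..t x}. \<forall>z\<in>{..t x}. y \<noteq> z \<longrightarrow> ?U y \<inter> ?U z = {}"
      by (auto dest!: fun_cong[where x = x])
  qed (auto simp: finite_bounded_fillings assms)
  moreover have "card (?U y) = card (bounded_fillings A t (a - int y))" for y
  proof (rule card_image, rule inj_onI)
    fix f g assume fg: "f \<in> bounded_fillings A t (a - int y)" "g \<in> bounded_fillings A t (a - int y)"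
      and eq: "f(x := y) = g(x := y)"
    have "f x = g x" using fg assms(2) by (simp add: bounded_fillings_def)
    then show "f = g"
      using eq by (metis fun_upd_triv fun_upd_upd)
  qed
  ultimately show ?thesis by simp
qed

text \<open>These cardinalities are the coefficients of the product of the polynomials
  \<open>1 + x + \<dots> + x ^ t i\<close>, a symmetric unimodal sequence. Symmetry and unimodality are combined into
  one inequality that is stable under induction: adding a point with bound \<open>T\<close> replaces the
  sequence by its sums over windows of length \<open>T + 1\<close>, and reflection at the common centre of two
  windows compares the parts that they do not share.\<close>

lemma card_bounded_fillings_mono:
  assumes "finite A" "a \<le> b" "a + b \<le> int (sum t A)"
  shows "card (bounded_fillings A t a) \<le> card (bounded_fillings A t b)"
  using assms
proof (induction A arbitrary: a b rule: finite_induct)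
  case empty
  show ?case
  proof (cases "a = 0")
    case True
    then show ?thesis using empty by simp
  next
    case False
    then show ?thesis by (simp add: bounded_fillings_def)
  qed
next
  case (insert x A)
  define T where "T = int (t x)"
  define w where "w = (\<lambda>z. card (bounded_fillings A t z))"
  have T: "T \<ge> 0" by (simp add: T_def)
  have window: "card (bounded_fillings (insert x A) t c) = sum w {c - T..c}" for c
  proof -
    have "(\<Sum>y\<le>t x. w (c - int y)) = sum w {c - T..c}"
      by (rule sum.reindex_bij_witness[of _ "\<lambda>z. nat (c - z)" "\<lambda>y. c - int y"])
        (auto simp: T_def)
    then show ?thesis
      using insert.hyps by (simp add: card_bounded_fillings_insert w_def)
  qed
  let ?P = "{a - T..a}" and ?Q = "{b - T..b}"
  \<comment> \<open>The reflection at the common centre of the windows \<open>?P\<close> and \<open>?Q\<close> exchanges them.\<close>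
  have "sum w (?P - ?Q) \<le> sum (\<lambda>z. w (a + b - T - z)) (?P - ?Q)"
  proof (rule sum_mono)
    fix z assume z: "z \<in> ?P - ?Q"
    then have "z \<le> a + b - T - z" "z + (a + b - T - z) \<le> int (sum t A)"
      using insert.prems insert.hyps by (auto simp: T_def)
    then show "w z \<le> w (a + b - T - z)"
      unfolding w_def by (rule insert.IH)
  qed
  also have "\<dots> = sum w (?Q - ?P)"
    using insert.prems(1) T
    by (intro sum.reindex_bij_witness[of _ "\<lambda>z. a + b - T - z" "\<lambda>z. a + b - T - z"]) auto
  finally have "sum w (?P - ?Q) \<le> sum w (?Q - ?P)" .
  then have "sum w ?P \<le> sum w ?Q"
    using sum.Int_Diff[of ?P w ?Q] sum.Int_Diff[of ?Q w ?P] by (simp add: Int_commute)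
  then show ?case by (simp add: window)
qed

definition fillings :: "'a set \<Rightarrow> nat \<Rightarrow> ('a \<Rightarrow> nat) set" where
  "fillings A s = {f. (\<forall>x. x \<notin> A \<longrightarrow> f x = 0) \<and> sum f A = s}"

lemma card_bounded_fillings_unbounded:
  assumes "finite A" "A \<noteq> {}" "s \<le> T"
  shows "card (bounded_fillings A (\<lambda>_. T) (int s)) = (s + card A - 1) choose s"
  using assms
proof (induction A arbitrary: s rule: finite_ne_induct)
  case (singleton x)
  have "bounded_fillings {x} (\<lambda>_. T) (int s) = {(\<lambda>_. 0)(x := s)}"
    using singleton by (auto simp: bounded_fillings_def fun_eq_iff)
  then show ?case by simp
next
  case (insert x A)
  then obtain m where m: "card A = Suc m"
    by (metis card_gt_0_iff gr0_implies_Suc)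
  have "card (bounded_fillings (insert x A) (\<lambda>_. T) (int s)) =
      (\<Sum>y\<le>T. card (bounded_fillings A (\<lambda>_. T) (int s - int y)))"
    using insert.hyps by (simp add: card_bounded_fillings_insert)
  also have "\<dots> = (\<Sum>y\<le>s. card (bounded_fillings A (\<lambda>_. T) (int s - int y)))"
  proof (rule sum.mono_neutral_right)
    have "bounded_fillings A (\<lambda>_. T) z = {}" if "z < 0" for z
      using that by (auto simp: bounded_fillings_def simp del: of_nat_sum)
    then show "\<forall>y\<in>{..T} - {..s}. card (bounded_fillings A (\<lambda>_. T) (int s - int y)) = 0"
      by simp
  qed (use insert.prems in auto)
  also have "\<dots> = (\<Sum>y\<le>s. (s - y + card A - 1) choose (s - y))"
  proof (rule sum.cong)
    fix y assume "y \<in> {..s}"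
    then have "int s - int y = int (s - y)" "s - y \<le> T"
      using insert.prems by auto
    then show "card (bounded_fillings A (\<lambda>_. T) (int s - int y)) = (s - y + card A - 1) choose (s - y)"
      using insert.IH by metis
  qed simp
  also have "\<dots> = (\<Sum>y\<le>s. (y + card A - 1) choose y)"
    by (rule sum.reindex_bij_witness[of _ "\<lambda>z. s - z" "\<lambda>z. s - z"]) auto
  also have "\<dots> = (\<Sum>y\<le>s. (card A - 1 + y) choose y)"
    using m by (simp add: add.commute)
  also have "\<dots> = (card A - 1 + s + 1) choose s"
    using sum_choose_lower[of "card A - 1" s] by simp
  also have "card A - 1 + s + 1 = s + card (insert x A) - 1"
    using insert.hyps m by simp
  finally show ?case .
qed

lemma card_fillings:
  assumes "finite A" "A \<noteq> {}"
  shows "card (fillings A s) = (s + card A - 1) choose s"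
proof -
  have "f x \<le> sum f A" if "x \<in> A" for f :: "'a \<Rightarrow> nat" and x
    using that assms(1) by (intro member_le_sum) auto
  then have "fillings A s = bounded_fillings A (\<lambda>_. s) (int s)"
    by (auto simp: fillings_def bounded_fillings_def simp del: of_nat_sum)
  then show ?thesis
    using card_bounded_fillings_unbounded[OF assms, of s s] by simp
qed

section \<open>Balancing the columns of a contingency table\<close>

abbreviation num_tables :: "nat \<Rightarrow> nat \<Rightarrow> (nat \<Rightarrow> nat) \<Rightarrow> (nat \<Rightarrow> nat) \<Rightarrow> nat" where
  "num_tables m n r c \<equiv> card (contingency_tables m n r c)"

lemma contingency_tables_cong:
  assumes "\<And>i. i \<in> {1..m} \<Longrightarrow> r i = r' i" "\<And>j. j \<in> {1..n} \<Longrightarrow> c j = c' j"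
  shows "contingency_tables m n r c = contingency_tables m n r' c'"
  using assms by (simp add: contingency_tables_def)

lemma num_tables_transpose: "num_tables m n r c = num_tables n m c r"
proof (rule bij_betw_same_card)
  show "bij_betw (\<lambda>X i j. X j i) (contingency_tables m n r c) (contingency_tables n m c r)"
    by (rule bij_betw_byWitness[where f' = "\<lambda>X i j. X j i"])
      (auto simp: contingency_tables_def)
qed

lemma sum_remove_two:
  assumes "finite J" "j1 \<in> J" "j2 \<in> J" "j1 \<noteq> j2"
  shows "sum h J = h j1 + (h j2 + sum h (J - {j1} - {j2}))"
  using assms by (simp add: sum.remove[of J j1] sum.remove[of "J - {j1}" j2])

text \<open>A table is the same as the table in which column \<open>j2\<close> has been added to column \<open>j1\<close>,
  together with the former column \<open>j2\<close>, which can be any vector of the right sum that is bounded by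
  the merged column.\<close>

lemma num_tables_merge_columns:
  fixes c :: "nat \<Rightarrow> nat"
  assumes j: "j1 \<in> {1..n}" "j2 \<in> {1..n}" "j1 \<noteq> j2"
  shows "num_tables m n r c =
    (\<Sum>Y\<in>contingency_tables m n r (c(j1 := c j1 + c j2, j2 := 0)).
        card (bounded_fillings {1..m} (\<lambda>i. Y i j1) (int (c j2))))"
proof -
  let ?M = "contingency_tables m n r (c(j1 := c j1 + c j2, j2 := 0))"
  let ?B = "\<lambda>Y. bounded_fillings {1..m} (\<lambda>i. Y i j1) (int (c j2))"
  define merge where "merge = (\<lambda>X :: nat \<Rightarrow> nat \<Rightarrow> nat. (\<lambda>i. (X i)(j1 := X i j1 + X i j2, j2 := 0)))"
  define split where "split = (\<lambda>(Y :: nat \<Rightarrow> nat \<Rightarrow> nat, x). (\<lambda>i. (Y i)(j1 := Y i j1 - x i, j2 := x i)))"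
  have cols: "sum h {1..n} = h j1 + (h j2 + sum h ({1..n} - {j1} - {j2}))" for h :: "nat \<Rightarrow> nat"
    using j by (intro sum_remove_two) auto
  have upd: "sum (h(j1 := a, j2 := b)) {1..n} = a + (b + sum h ({1..n} - {j1} - {j2}))"
    for h :: "nat \<Rightarrow> nat" and a b
  proof -
    have "sum (h(j1 := a, j2 := b)) ({1..n} - {j1} - {j2}) = sum h ({1..n} - {j1} - {j2})"
      by (intro sum.cong) auto
    then show ?thesis
      using j(3) unfolding cols[of "h(j1 := a, j2 := b)"] by simp
  qed
  have row_merge: "sum (merge X i) {1..n} = sum (X i) {1..n}" for X i
    unfolding merge_def upd cols[of "X i"] by simp
  have row_split: "sum (split (Y, x) i) {1..n} = sum (Y i) {1..n}"
    if "x i \<le> Y i j1" "Y i j2 = 0" for Y x i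
    using that unfolding split_def prod.case upd cols[of "Y i"] by simp
  have "bij_betw (\<lambda>X. (merge X, \<lambda>i. X i j2)) (contingency_tables m n r c) (Sigma ?M ?B)"
  proof (rule bij_betw_byWitness[where f' = split])
    show "\<forall>X\<in>contingency_tables m n r c. split (merge X, \<lambda>i. X i j2) = X"
      using j(3) by (auto simp: split_def merge_def fun_eq_iff)
    have zero: "Y i j2 = 0" if "Y \<in> ?M" for Y i
    proof (cases "i \<in> {1..m}")
      case True
      have "(\<Sum>i=1..m. Y i j2) = 0"
        using that j by (auto simp: contingency_tables_def)
      then show ?thesis using True by simp
    qed (use that in \<open>auto simp: contingency_tables_def\<close>)
    have le: "x i \<le> Y i j1" if "Y \<in> ?M" "x \<in> ?B Y" for Y x i
      using that by (cases "i \<in> {1..m}") (auto simp: bounded_fillings_def)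
    show "\<forall>p\<in>Sigma ?M ?B. (merge (split p), \<lambda>i. split p i j2) = p"
    proof
      fix p assume "p \<in> Sigma ?M ?B"
      then obtain Y x where p: "p = (Y, x)" and Y: "Y \<in> ?M" and x: "x \<in> ?B Y" by blast
      show "(merge (split p), \<lambda>i. split p i j2) = p"
        using j(3) zero[OF Y] le[OF Y x]
        by (auto simp: p split_def merge_def fun_eq_iff)
    qed
    show "(\<lambda>X. (merge X, \<lambda>i. X i j2)) ` contingency_tables m n r c \<subseteq> Sigma ?M ?B"
    proof (rule image_subsetI)
      fix X assume X: "X \<in> contingency_tables m n r c"
      have "merge X \<in> ?M"
        unfolding contingency_tables_def mem_Collect_eq row_merge
      proof (intro conjI ballI allI impI)
        fix i assume "i \<in> {1..m}"
        then show "sum (X i) {1..n} = r i" using X by (simp add: contingency_tables_def)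
      next
        fix l assume "l \<in> {1..n}"
        then show "(\<Sum>i=1..m. merge X i l) = (c(j1 := c j1 + c j2, j2 := 0)) l"
          using X j by (auto simp: contingency_tables_def merge_def sum.distrib)
      next
        fix i l assume "i \<notin> {1..m} \<or> l \<notin> {1..n}"
        then show "merge X i l = 0"
          using X j by (auto simp: contingency_tables_def merge_def)
      qed
      moreover have "(\<lambda>i. X i j2) \<in> ?B (merge X)"
        using X j by (auto simp: contingency_tables_def merge_def bounded_fillings_def simp del: of_nat_sum)
      ultimately show "(merge X, \<lambda>i. X i j2) \<in> Sigma ?M ?B" by blast
    qed
    show "split ` Sigma ?M ?B \<subseteq> contingency_tables m n r c"
    proof (rule image_subsetI)
      fix p assume "p \<in> Sigma ?M ?B"
      then obtain Y x where p: "p = (Y, x)" and Y: "Y \<in> ?M" and x: "x \<in> ?B Y" by blast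
      have sx: "sum x {1..m} = c j2"
        using x by (simp add: bounded_fillings_def del: of_nat_sum)
      show "split p \<in> contingency_tables m n r c"
        unfolding p contingency_tables_def mem_Collect_eq
      proof (intro conjI ballI allI impI)
        fix i assume "i \<in> {1..m}"
        then have "sum (Y i) {1..n} = r i" using Y by (simp add: contingency_tables_def)
        then show "sum (split (Y, x) i) {1..n} = r i"
          using row_split[where Y = Y and x = x and i = i] le[OF Y x] zero[OF Y] by simp
      next
        fix l assume l: "l \<in> {1..n}"
        have col: "(\<Sum>i=1..m. Y i l) = (c(j1 := c j1 + c j2, j2 := 0)) l"
          if "l \<in> {1..n}" for l using Y that by (simp add: contingency_tables_def)
        have "(\<Sum>i=1..m. Y i j1 - x i) = (\<Sum>i=1..m. Y i j1) - sum x {1..m}"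
          using le[OF Y x] by (intro sum_subtractf_nat) auto
        then have "(\<Sum>i=1..m. Y i j1 - x i) = c j1"
          using col[OF j(1)] j(3) sx by simp
        then show "(\<Sum>i=1..m. split (Y, x) i l) = c l"
          using col[OF l] sx j(3) by (auto simp: split_def split: if_splits)
      next
        fix i l assume "i \<notin> {1..m} \<or> l \<notin> {1..n}"
        then show "split (Y, x) i l = 0"
          using Y x j by (auto simp: contingency_tables_def bounded_fillings_def split_def)
      qed
    qed
  qed
  then have "num_tables m n r c = card (Sigma ?M ?B)"
    by (rule bij_betw_same_card)
  also have "\<dots> = (\<Sum>Y\<in>?M. card (?B Y))"
    by (rule card_SigmaI) (auto simp: finite_contingency_tables finite_bounded_fillings)
  finally show ?thesis .
qed

text \<open>The transfer does not change the merged tables, and for each of them it moves the sum of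
  the split-off column towards the middle of a unimodal sequence.\<close>

lemma num_tables_transfer:
  assumes j: "j1 \<in> {1..n}" "j2 \<in> {1..n}" and less: "c j2 < c j1"
  shows "num_tables m n r c \<le> num_tables m n r (c(j1 := c j1 - 1, j2 := c j2 + 1))"
proof -
  let ?c = "c(j1 := c j1 - 1, j2 := c j2 + 1)"
  have ne: "j1 \<noteq> j2" using less by auto
  have merged: "?c(j1 := ?c j1 + ?c j2, j2 := 0) = c(j1 := c j1 + c j2, j2 := 0)"
    using less ne by (auto simp: fun_eq_iff)
  have "card (bounded_fillings {1..m} (\<lambda>i. Y i j1) (int (c j2))) \<le>
      card (bounded_fillings {1..m} (\<lambda>i. Y i j1) (int (?c j2)))"
    if "Y \<in> contingency_tables m n r (c(j1 := c j1 + c j2, j2 := 0))" for Y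
  proof (rule card_bounded_fillings_mono)
    have "(\<Sum>i=1..m. Y i j1) = c j1 + c j2"
      using that j ne by (simp add: contingency_tables_def)
    then show "int (c j2) + int (?c j2) \<le> int (\<Sum>i=1..m. Y i j1)"
      using less by (simp del: of_nat_sum)
  qed auto
  then show ?thesis
    unfolding num_tables_merge_columns[OF j ne, of m r c]
      num_tables_merge_columns[OF j ne, of m r ?c] merged
    by (rule sum_mono)
qed

text \<open>As long as the columns in \<open>J\<close> are not level, there is one above and one below the average
  \<open>u\<close>, and a unit transfer between them decreases the total deviation from \<open>u\<close>.\<close>

lemma num_tables_le_levelled_columns:
  assumes "J \<subseteq> {1..n}" "sum c J = card J * u"
  shows "num_tables m n r c \<le> num_tables m n r (\<lambda>j. if j \<in> J then u else c j)"
  using assms(2)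
proof (induction "\<Sum>j\<in>J. nat \<bar>int (c j) - int u\<bar>" arbitrary: c rule: less_induct)
  case less
  have fin: "finite J" using assms(1) finite_subset by blast
  show ?case
  proof (cases "\<forall>j\<in>J. c j = u")
    case True
    then have "(\<lambda>j. if j \<in> J then u else c j) = c" by auto
    then show ?thesis by simp
  next
    case False
    have "\<exists>j1\<in>J. u < c j1"
    proof (rule ccontr)
      assume "\<not> ?thesis"
      then have "\<And>j. j \<in> J \<Longrightarrow> c j \<le> u" by force
      moreover obtain j where "j \<in> J" "c j < u"
        using False calculation by force
      ultimately have "sum c J < sum (\<lambda>_. u) J"
        using fin by (intro sum_strict_mono_ex1) auto
      then show False using less.prems by simp
    qed
    then obtain j1 where j1: "j1 \<in> J" "u < c j1" by blast
    have "\<exists>j2\<in>J. c j2 < u"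
    proof (rule ccontr)
      assume "\<not> ?thesis"
      then have "\<And>j. j \<in> J \<Longrightarrow> u \<le> c j" by force
      then have "sum (\<lambda>_. u) J < sum c J"
        using fin j1 by (intro sum_strict_mono_ex1) auto
      then show False using less.prems by simp
    qed
    then obtain j2 where j2: "j2 \<in> J" "c j2 < u" by blast
    let ?c = "c(j1 := c j1 - 1, j2 := c j2 + 1)"
    have ne: "j1 \<noteq> j2" using j1 j2 by auto
    have parts: "sum h J = h j1 + (h j2 + sum h (J - {j1} - {j2}))" for h :: "nat \<Rightarrow> nat"
      using j1 j2 ne fin by (intro sum_remove_two) auto
    have rest: "sum (\<lambda>j. g (?c j)) (J - {j1} - {j2}) = sum (\<lambda>j. g (c j)) (J - {j1} - {j2})"
      for g :: "nat \<Rightarrow> nat"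
      by (intro sum.cong) auto
    have "num_tables m n r c \<le> num_tables m n r ?c"
      using assms(1) j1 j2 by (intro num_tables_transfer) auto
    also have "\<dots> \<le> num_tables m n r (\<lambda>j. if j \<in> J then u else ?c j)"
    proof (rule less.hyps)
      show "(\<Sum>j\<in>J. nat \<bar>int (?c j) - int u\<bar>) < (\<Sum>j\<in>J. nat \<bar>int (c j) - int u\<bar>)"
        unfolding parts[of "\<lambda>j. nat \<bar>int (?c j) - int u\<bar>"] parts[of "\<lambda>j. nat \<bar>int (c j) - int u\<bar>"]
          rest[of "\<lambda>z. nat \<bar>int z - int u\<bar>"]
        using j1 j2 ne by simp
      show "sum ?c J = card J * u"
        using less.prems rest[of "\<lambda>z. z"] j1 j2 ne unfolding parts[of ?c] parts[of c] by simp
    qed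
    also have "(\<lambda>j. if j \<in> J then u else ?c j) = (\<lambda>j. if j \<in> J then u else c j)"
      using j1 j2 by auto
    finally show ?thesis .
  qed
qed

section \<open>Tables with two-valued margins and matrices with given block sums\<close>

definition split_margin :: "nat \<Rightarrow> nat \<Rightarrow> nat \<Rightarrow> nat \<Rightarrow> nat" where
  "split_margin k u v i = (if i \<le> k then u else v)"

abbreviation split_tables :: "nat \<Rightarrow> nat \<Rightarrow> nat \<Rightarrow> nat \<Rightarrow> (nat \<Rightarrow> nat \<Rightarrow> nat) set" where
  "split_tables k n u v \<equiv> contingency_tables (k + n) (k + n) (split_margin k u v) (split_margin k u v)"

definition heavy_sum :: "nat \<Rightarrow> (nat \<Rightarrow> nat \<Rightarrow> nat) \<Rightarrow> nat" where
  "heavy_sum k X = (\<Sum>i=1..k. \<Sum>j=1..k. X i j)"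

lemma num_tables_le_levelled_both_columns:
  assumes "sum c {1..k} = k * u" "sum c {k+1..k+n} = n * v"
  shows "num_tables m (k + n) r c \<le> num_tables m (k + n) r (split_margin k u v)"
proof -
  let ?c = "\<lambda>j. if j \<in> {1..k} then u else c j"
  have "num_tables m (k + n) r c \<le> num_tables m (k + n) r ?c"
    using assms(1) by (intro num_tables_le_levelled_columns) auto
  also have "\<dots> \<le> num_tables m (k + n) r (\<lambda>j. if j \<in> {k+1..k+n} then v else ?c j)"
  proof (rule num_tables_le_levelled_columns)
    have "sum ?c {k+1..k+n} = sum c {k+1..k+n}"
      by (intro sum.cong) auto
    then show "sum ?c {k+1..k+n} = card {k+1..k+n} * v"
      using assms(2) by simp
  qed auto
  also have "\<dots> = num_tables m (k + n) r (split_margin k u v)"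
    by (intro arg_cong[where f = card] contingency_tables_cong) (auto simp: split_margin_def)
  finally show ?thesis .
qed

lemma num_tables_le_split_tables:
  assumes "sum r {1..k} = k * u" "sum r {k+1..k+n} = n * v"
    and "sum c {1..k} = k * u" "sum c {k+1..k+n} = n * v"
  shows "num_tables (k + n) (k + n) r c \<le> card (split_tables k n u v)"
proof -
  have "num_tables (k + n) (k + n) r c \<le> num_tables (k + n) (k + n) r (split_margin k u v)"
    by (rule num_tables_le_levelled_both_columns) fact+
  also have "\<dots> = num_tables (k + n) (k + n) (split_margin k u v) r"
    by (rule num_tables_transpose)
  also have "\<dots> \<le> card (split_tables k n u v)"
    by (rule num_tables_le_levelled_both_columns) fact+
  finally show ?thesis .
qed

definition block_fillings :: "'a set \<Rightarrow> ('a \<Rightarrow> 'p) \<Rightarrow> ('p \<Rightarrow> nat) \<Rightarrow> ('a \<Rightarrow> nat) set" where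
  "block_fillings D g a =
     {f. (\<forall>x. x \<notin> D \<longrightarrow> f x = 0) \<and> (\<forall>p. sum f {x\<in>D. g x = p} = a p)}"

lemma card_block_fillings:
  fixes g :: "'a \<Rightarrow> 'p :: finite"
  shows "card (block_fillings D g a) = (\<Prod>p\<in>UNIV. card (fillings {x\<in>D. g x = p} (a p)))"
proof -
  let ?F = "PiE UNIV (\<lambda>p. fillings {x\<in>D. g x = p} (a p))"
  let ?cut = "\<lambda>f p x. if x \<in> D \<and> g x = p then f x else (0::nat)"
  let ?glue = "\<lambda>h x. if x \<in> D then h (g x) x else (0::nat)"
  have "bij_betw ?cut (block_fillings D g a) ?F"
  proof (rule bij_betw_byWitness[where f' = ?glue])
    show "\<forall>f\<in>block_fillings D g a. ?glue (?cut f) = f"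
      by (auto simp: block_fillings_def fun_eq_iff)
    show "\<forall>h\<in>?F. ?cut (?glue h) = h"
    proof
      fix h assume "h \<in> ?F"
      then have "h p x = 0" if "\<not> (x \<in> D \<and> g x = p)" for p x
        using that by (auto simp: PiE_def Pi_def fillings_def)
      then show "?cut (?glue h) = h"
        by (auto simp: fun_eq_iff)
    qed
    show "?cut ` block_fillings D g a \<subseteq> ?F"
    proof (rule image_subsetI)
      fix f assume f: "f \<in> block_fillings D g a"
      have "sum (?cut f p) {x\<in>D. g x = p} = sum f {x\<in>D. g x = p}" for p
        by (intro sum.cong) auto
      then show "?cut f \<in> ?F"
        using f by (auto simp: block_fillings_def fillings_def PiE_def Pi_def)
    qed
    show "?glue ` ?F \<subseteq> block_fillings D g a"
    proof (rule image_subsetI)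
      fix h assume h: "h \<in> ?F"
      have "sum (?glue h) {x\<in>D. g x = p} = sum (h p) {x\<in>D. g x = p}" for p
        by (intro sum.cong) auto
      then show "?glue h \<in> block_fillings D g a"
        using h by (auto simp: block_fillings_def fillings_def PiE_def Pi_def)
    qed
  qed
  then have "card (block_fillings D g a) = card ?F"
    by (rule bij_betw_same_card)
  then show ?thesis by (simp add: card_PiE)
qed

definition num_fillings :: "nat \<Rightarrow> nat \<Rightarrow> nat" where
  "num_fillings a s = (s + a - 1) choose s"

definition block_count :: "nat \<Rightarrow> nat \<Rightarrow> nat \<Rightarrow> nat \<Rightarrow> nat \<Rightarrow> nat" where
  "block_count k n u v s =
     num_fillings (k * k) s * num_fillings (k * n) (k * u - s) ^ 2 *
     num_fillings (n * n) (n * v - k * u + s)"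

definition cells :: "nat \<Rightarrow> nat \<Rightarrow> (nat \<times> nat) set" where
  "cells k n = {1..k+n} \<times> {1..k+n}"

definition block :: "nat \<Rightarrow> nat \<times> nat \<Rightarrow> bool \<times> bool" where
  "block k = (\<lambda>(i, j). (i \<le> k, j \<le> k))"

text \<open>The flags of a block tell whether its rows and whether its columns are heavy.\<close>

definition block_sums :: "nat \<Rightarrow> nat \<Rightarrow> nat \<Rightarrow> nat \<Rightarrow> nat \<Rightarrow> bool \<times> bool \<Rightarrow> nat" where
  "block_sums k n u v s = (\<lambda>(p, q). if p \<and> q then s else if p \<or> q then k * u - s else n * v - k * u + s)"

definition side :: "nat \<Rightarrow> nat \<Rightarrow> bool \<Rightarrow> nat set" where
  "side k n p = (if p then {1..k} else {k+1..k+n})"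

lemma cells_block: "{x \<in> cells k n. block k x = (p, q)} = side k n p \<times> side k n q"
  by (auto simp: cells_def block_def side_def)

lemma finite_side [simp]: "finite (side k n p)"
  by (simp add: side_def)

lemma sum_sides: "sum f {1..k+n} = sum f (side k n True) + sum f (side k n False)"
  for f :: "nat \<Rightarrow> nat"
proof -
  have "{1..k+n} = side k n True \<union> side k n False" by (auto simp: side_def)
  then show ?thesis by (simp add: sum.union_disjoint side_def)
qed

lemma card_block_fillings_cells:
  assumes "k > 0" "n > 0"
  shows "card (block_fillings (cells k n) (block k) (block_sums k n u v s)) = block_count k n u v s"
proof -
  have *: "card (fillings {x \<in> cells k n. block k x = (p, q)} t) =
      num_fillings (card (side k n p) * card (side k n q)) t" for p q t
    unfolding cells_block num_fillings_def using assms
    by (subst card_fillings) (auto simp: side_def card_cartesian_product)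
  have UNIV_eq: "(UNIV :: (bool \<times> bool) set) = {(True, True), (True, False), (False, True), (False, False)}"
    by auto
  show ?thesis
    unfolding card_block_fillings UNIV_eq
    by (simp add: * block_count_def block_sums_def side_def power2_eq_square mult.commute[of n k])
qed

lemma block_count_pos:
  assumes "k > 0" "n > 0"
  shows "block_count k n u v s > 0"
proof -
  have "num_fillings a t > 0" if "a > 0" for a t
    using that by (simp add: num_fillings_def)
  then show ?thesis
    using assms by (simp add: block_count_def)
qed

text \<open>The margins and the heavy-by-heavy sum determine the sums of the other three blocks.\<close>

lemma card_heavy_sum_le:
  assumes "k > 0" "n > 0" "k * u \<le> n * v"
  shows "card {X \<in> split_tables k n u v. heavy_sum k X = s} \<le> block_count k n u v s"
proof -
  let ?B = "block_fillings (cells k n) (block k) (block_sums k n u v s)"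
  have "finite ?B"
    using block_count_pos[of k n u v s] assms
    by (intro card_ge_0_finite) (simp add: card_block_fillings_cells)
  moreover have "inj_on case_prod {X \<in> split_tables k n u v. heavy_sum k X = s}"
    by (auto simp: inj_on_def fun_eq_iff)
  moreover have "case_prod ` {X \<in> split_tables k n u v. heavy_sum k X = s} \<subseteq> ?B"
  proof (rule image_subsetI)
    fix X assume "X \<in> {X \<in> split_tables k n u v. heavy_sum k X = s}"
    then have X: "X \<in> split_tables k n u v" and s: "heavy_sum k X = s" by auto
    define b where "b p q = (\<Sum>i\<in>side k n p. \<Sum>j\<in>side k n q. X i j)" for p q
    have rows: "b p True + b p False = (\<Sum>i\<in>side k n p. split_margin k u v i)" for p
    proof -
      have "b p True + b p False = (\<Sum>i\<in>side k n p. sum (X i) {1..k+n})"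
        unfolding b_def sum_sides sum.distrib ..
      also have "\<dots> = (\<Sum>i\<in>side k n p. split_margin k u v i)"
        using X by (intro sum.cong) (auto simp: contingency_tables_def side_def split: if_splits)
      finally show ?thesis .
    qed
    have cols: "b True q + b False q = (\<Sum>i\<in>side k n q. split_margin k u v i)" for q
    proof -
      have "b True q + b False q = (\<Sum>j\<in>side k n q. \<Sum>i=1..k+n. X i j)"
        unfolding b_def sum_sides sum.distrib
        by (simp add: sum.swap[of _ "side k n q"])
      also have "\<dots> = (\<Sum>i\<in>side k n q. split_margin k u v i)"
        using X by (intro sum.cong) (auto simp: contingency_tables_def side_def split: if_splits)
      finally show ?thesis .
    qed
    have marg: "(\<Sum>i\<in>side k n True. split_margin k u v i) = k * u"
      "(\<Sum>i\<in>side k n False. split_margin k u v i) = n * v"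
      by (simp_all add: side_def split_margin_def)
    have "b True True = s"
      using s by (simp add: b_def heavy_sum_def side_def)
    then have "b p q = block_sums k n u v s (p, q)" for p q
      using rows[of True] rows[of False] cols[of True] assms(3)
      unfolding marg by (cases p; cases q) (auto simp: block_sums_def)
    then have "sum (case_prod X) {x \<in> cells k n. block k x = p} = block_sums k n u v s p" for p
      by (cases p) (simp add: cells_block b_def flip: sum.cartesian_product)
    then show "case_prod X \<in> ?B"
      using X by (auto simp: block_fillings_def cells_def contingency_tables_def)
  qed
  ultimately have "card {X \<in> split_tables k n u v. heavy_sum k X = s} \<le> card ?B"
    by (intro card_inj_on_le)
  then show ?thesis
    using assms by (simp add: card_block_fillings_cells)
qed

text \<open>A matrix with these block sums is a table for its own row and column sums. These are
  vectors with entries at most \<open>k * u + n * v\<close>, which bounds the number of pairs of them, and each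
  pair admits at most as many tables as the margins that are level on both classes.\<close>

lemma block_count_le:
  assumes "k > 0" "n > 0" "k * u \<le> n * v" "s \<le> k * u"
  shows "block_count k n u v s \<le> (k * u + n * v + 1) ^ (2 * (k + n)) * card (split_tables k n u v)"
proof -
  let ?R = "k * u + n * v" and ?N = "k + n"
  let ?B = "block_fillings (cells k n) (block k) (block_sums k n u v s)"
  \<comment> \<open>The product set consists of functions that are undefined outside the index range; only their
      values inside it matter for the tables.\<close>
  define M where "M = {r \<in> PiE {1..?N} (\<lambda>_. {..?R}).
     sum r {1..k} = k * u \<and> sum r {k+1..k+n} = n * v}"
  have M_sub: "M \<subseteq> PiE {1..?N} (\<lambda>_. {..?R})" by (auto simp: M_def)
  have fin: "finite (PiE {1..?N} (\<lambda>_. {..?R}))" by (intro finite_PiE) auto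
  have card_M: "card M \<le> (?R + 1) ^ ?N"
    using card_mono[OF fin M_sub] by (simp add: card_PiE)
  have finM: "finite M" using M_sub fin finite_subset by blast
  let ?T = "\<Union>(r, c)\<in>M \<times> M. contingency_tables ?N ?N r c"
  have "curry ` ?B \<subseteq> ?T"
  proof (rule image_subsetI)
    fix f assume f: "f \<in> ?B"
    have b: "(\<Sum>i\<in>side k n p. \<Sum>j\<in>side k n q. f (i, j)) = block_sums k n u v s (p, q)" for p q
    proof -
      have "sum f {x \<in> cells k n. block k x = (p, q)} = block_sums k n u v s (p, q)"
        using f by (simp add: block_fillings_def)
      then show ?thesis
        unfolding cells_block by (simp add: sum.cartesian_product)
    qed
    define r where "r = restrict (\<lambda>i. \<Sum>j=1..?N. f (i, j)) {1..?N}"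
    define c where "c = restrict (\<lambda>j. \<Sum>i=1..?N. f (i, j)) {1..?N}"
    have r_side: "sum r (side k n p) = (if p then k * u else n * v)" for p
    proof -
      have "sum r (side k n p) = (\<Sum>i\<in>side k n p. \<Sum>j=1..?N. f (i, j))"
        by (intro sum.cong) (auto simp: r_def side_def split: if_splits)
      also have "\<dots> = block_sums k n u v s (p, True) + block_sums k n u v s (p, False)"
        unfolding sum_sides sum.distrib b ..
      finally show ?thesis using assms by (auto simp: block_sums_def)
    qed
    have c_side: "sum c (side k n p) = (if p then k * u else n * v)" for p
    proof -
      have "sum c (side k n p) = (\<Sum>j\<in>side k n p. \<Sum>i=1..?N. f (i, j))"
        by (intro sum.cong) (auto simp: c_def side_def split: if_splits)
      also have "\<dots> = (\<Sum>i\<in>side k n True. \<Sum>j\<in>side k n p. f (i, j)) +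
          (\<Sum>i\<in>side k n False. \<Sum>j\<in>side k n p. f (i, j))"
        unfolding sum_sides sum.distrib by (simp add: sum.swap[of _ "side k n p"])
      also have "\<dots> = block_sums k n u v s (True, p) + block_sums k n u v s (False, p)"
        unfolding b ..
      finally show ?thesis using assms by (auto simp: block_sums_def)
    qed
    have M_I: "h \<in> M" if "h \<in> extensional {1..?N}"
      and side: "\<And>p. sum h (side k n p) = (if p then k * u else n * v)" for h
    proof -
      have "sum h {1..?N} = ?R" using side[of True] side[of False] unfolding sum_sides by simp
      then have "h i \<le> ?R" if "i \<in> {1..?N}" for i
        using member_le_sum[of i "{1..?N}" h] that by auto
      then show ?thesis
        using that side[of True] side[of False] by (auto simp: M_def side_def PiE_def)
    qed
    have "r \<in> M" "c \<in> M"
      by (intro M_I r_side c_side; simp add: r_def c_def)+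
    moreover have "curry f \<in> contingency_tables ?N ?N r c"
      using f by (auto simp: contingency_tables_def r_def c_def block_fillings_def cells_def)
    ultimately show "curry f \<in> ?T" by blast
  qed
  moreover have "finite ?T"
    using finM by (auto simp: finite_contingency_tables)
  moreover have "inj_on curry ?B"
    by (auto simp: inj_on_def fun_eq_iff curry_def)
  ultimately have "card ?B \<le> card ?T"
    by (intro card_inj_on_le)
  also have "\<dots> \<le> (\<Sum>(r, c)\<in>M \<times> M. num_tables ?N ?N r c)"
    using card_UN_le[of "M \<times> M" "\<lambda>(r, c). contingency_tables ?N ?N r c"] finM
    by (simp add: case_prod_unfold)
  also have "\<dots> \<le> (\<Sum>(r, c)\<in>M \<times> M. card (split_tables k n u v))"
    by (intro sum_mono) (auto simp: M_def intro!: num_tables_le_split_tables)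
  also have "\<dots> = card M * card M * card (split_tables k n u v)"
    by (simp add: card_cartesian_product)
  also have "\<dots> \<le> ((?R + 1) ^ ?N * (?R + 1) ^ ?N) * card (split_tables k n u v)"
    using card_M by (intro mult_mono) auto
  also have "(?R + 1) ^ ?N * (?R + 1) ^ ?N = (?R + 1) ^ (2 * ?N)"
    by (simp add: power_add mult_2)
  finally show ?thesis
    using assms by (simp add: card_block_fillings_cells)
qed

section \<open>From growth of the block count to the mean of the heavy block\<close>

lemma bij_betw_permute_tables:
  assumes p: "p permutes {1..m}" "\<And>i. r (p i) = r i"
    and q: "q permutes {1..n}" "\<And>j. c (q j) = c j"
  shows "bij_betw (\<lambda>X i j. X (p i) (q j)) (contingency_tables m n r c) (contingency_tables m n r c)"
proof -
  have permuted: "(\<lambda>i j. X (p i) (q j)) \<in> contingency_tables m n r c"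
    if X: "X \<in> contingency_tables m n r c" and p: "p permutes {1..m}" "\<And>i. r (p i) = r i"
      and q: "q permutes {1..n}" "\<And>j. c (q j) = c j" for X p q
  proof -
    have "(\<Sum>j=1..n. X (p i) (q j)) = (\<Sum>j=1..n. X (p i) j)" for i
      using sum.permute[OF q(1), of "X (p i)"] by (simp add: comp_def)
    moreover have "(\<Sum>i=1..m. X (p i) (q j)) = (\<Sum>i=1..m. X i (q j))" for j
      using sum.permute[OF p(1), of "\<lambda>i. X i (q j)"] by (simp add: comp_def)
    moreover have "p i \<in> {1..m} \<longleftrightarrow> i \<in> {1..m}" "q j \<in> {1..n} \<longleftrightarrow> j \<in> {1..n}" for i j
      using permutes_in_image p(1) q(1) by metis+
    ultimately show ?thesis
      using X p(2) q(2) unfolding contingency_tables_def mem_Collect_eq by metis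
  qed
  have inv: "r (inv p i) = r i" "c (inv q j) = c j" for i j
    using p q by (metis permutes_inverses(1))+
  show ?thesis
  proof (rule bij_betw_byWitness[where f' = "\<lambda>X i j. X (inv p i) (inv q j)"])
    show "(\<lambda>X i j. X (p i) (q j)) ` contingency_tables m n r c \<subseteq> contingency_tables m n r c"
      using permuted[OF _ p q] by blast
    show "(\<lambda>X i j. X (inv p i) (inv q j)) ` contingency_tables m n r c \<subseteq> contingency_tables m n r c"
      using permuted[OF _ permutes_inv[OF p(1)] inv(1) permutes_inv[OF q(1)] inv(2)] by blast
  qed (use p(1) q(1) in \<open>auto simp: permutes_inverses\<close>)
qed

lemma sum_heavy_sum:
  assumes "k > 0"
  shows "(\<Sum>X\<in>split_tables k n u v. heavy_sum k X) = k * k * (\<Sum>X\<in>split_tables k n u v. X 1 1)"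
proof -
  let ?T = "split_tables k n u v"
  have entry: "(\<Sum>X\<in>?T. X i j) = (\<Sum>X\<in>?T. X 1 1)" if ij: "i \<in> {1..k}" "j \<in> {1..k}" for i j
  proof -
    have perm: "Transposition.transpose 1 l permutes {1..k+n}"
      "split_margin k u v (Transposition.transpose 1 l a) = split_margin k u v a"
      if "l \<in> {1..k}" for l a
      using that by (auto intro!: permutes_swap_id simp: split_margin_def Transposition.transpose_def)
    have "bij_betw (\<lambda>X a b. X (Transposition.transpose 1 i a) (Transposition.transpose 1 j b)) ?T ?T"
      by (intro bij_betw_permute_tables perm ij)
    from sum.reindex_bij_betw[OF this, of "\<lambda>X. X 1 1"] show ?thesis by simp
  qed
  have "(\<Sum>X\<in>?T. heavy_sum k X) = (\<Sum>i=1..k. \<Sum>j=1..k. \<Sum>X\<in>?T. X i j)"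
    unfolding heavy_sum_def by (simp add: sum.swap[of _ _ ?T])
  also have "\<dots> = (\<Sum>i=1..k. \<Sum>j=1..k. \<Sum>X\<in>?T. X 1 1)"
    by (rule sum.cong[OF refl], rule sum.cong[OF refl], rule entry)
  finally show ?thesis by simp
qed

lemma heavy_sum_le:
  assumes "X \<in> split_tables k n u v"
  shows "heavy_sum k X \<le> k * u"
proof -
  have "heavy_sum k X \<le> (\<Sum>i=1..k. \<Sum>j=1..k+n. X i j)"
    unfolding heavy_sum_def by (intro sum_mono sum_mono2) auto
  also have "\<dots> = (\<Sum>i=1..k. u)"
    using assms by (intro sum.cong) (auto simp: contingency_tables_def split_margin_def)
  finally show ?thesis by simp
qed

definition mean_heavy_sum :: "nat \<Rightarrow> nat \<Rightarrow> nat \<Rightarrow> nat \<Rightarrow> real" where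
  "mean_heavy_sum k n u v =
     (\<Sum>X\<in>split_tables k n u v. real (heavy_sum k X)) / card (split_tables k n u v)"

lemma split_tables_nonempty: "split_tables k n u v \<noteq> {}"
proof -
  let ?N = "k + n"
  have "(\<lambda>i j. if i \<in> {1..?N} \<and> i = j then split_margin k u v i else 0) \<in> split_tables k n u v"
    unfolding contingency_tables_def by (auto simp: sum.delta cong: if_cong)
  then show ?thesis by blast
qed

lemma card_split_tables_pos: "card (split_tables k n u v) > 0"
  using split_tables_nonempty finite_contingency_tables by (metis card_gt_0_iff)

lemma expectation_corner:
  assumes "num_heavy \<delta> n > 0"
  shows "measure_pmf.expectation (uniform_table B C \<delta> n) (\<lambda>X. real (X 1 1)) =
    mean_heavy_sum (num_heavy \<delta> n) n (nat \<lfloor>B * C * real n\<rfloor>) (nat \<lfloor>C * real n\<rfloor>) / (real (num_heavy \<delta> n))\<^sup>2"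
proof -
  define k where "k = num_heavy \<delta> n"
  let ?u = "nat \<lfloor>B * C * real n\<rfloor>" and ?v = "nat \<lfloor>C * real n\<rfloor>"
  have "margin B C \<delta> n = split_margin k ?u ?v"
    by (auto simp: margin_def split_margin_def k_def fun_eq_iff)
  then have T: "two_margin_tables B C \<delta> n = split_tables k n ?u ?v"
    by (simp add: two_margin_tables_def k_def)
  have "real (\<Sum>X\<in>split_tables k n ?u ?v. heavy_sum k X) =
      real (k * k * (\<Sum>X\<in>split_tables k n ?u ?v. X 1 1))"
    using assms by (subst sum_heavy_sum) (auto simp: k_def)
  then show ?thesis
    using assms two_margin_tables_finite_nonempty[of B C \<delta> n]
    unfolding uniform_table_def mean_heavy_sum_def T
    by (simp add: integral_pmf_of_set k_def[symmetric] power2_eq_square)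
qed

text \<open>The factor lost in \<open>block_count_le\<close>: a bound on the number of pairs of row and column
  margins.\<close>

definition margin_pairs_bound :: "nat \<Rightarrow> nat \<Rightarrow> nat \<Rightarrow> nat \<Rightarrow> real" where
  "margin_pairs_bound k n u v = real (k * u + n * v + 1) ^ (2 * (k + n))"

lemma card_heavy_sum_le_ratio:
  assumes "k > 0" "n > 0" "k * u \<le> n * v" "s' \<le> k * u"
  shows "real (card {X \<in> split_tables k n u v. heavy_sum k X = s}) \<le>
    block_count k n u v s / block_count k n u v s' * margin_pairs_bound k n u v * card (split_tables k n u v)"
proof -
  let ?T = "split_tables k n u v" and ?F = "block_count k n u v"
  have "card {X \<in> ?T. heavy_sum k X = s} * ?F s' \<le> ?F s * ((k * u + n * v + 1) ^ (2 * (k + n)) * card ?T)"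
    by (intro mult_mono card_heavy_sum_le block_count_le assms) auto
  then have "real (card {X \<in> ?T. heavy_sum k X = s} * ?F s') \<le>
     real (?F s * ((k * u + n * v + 1) ^ (2 * (k + n)) * card ?T))"
    by (rule of_nat_mono)
  then show ?thesis
    using block_count_pos[of k n u v s'] assms
    by (simp add: margin_pairs_bound_def field_simps)
qed

lemma card_heavy_sum_in:
  "card {X \<in> split_tables k n u v. heavy_sum k X \<in> I} =
    (\<Sum>s\<in>I. card {X \<in> split_tables k n u v. heavy_sum k X = s})" if "finite I"
proof -
  have "{X \<in> split_tables k n u v. heavy_sum k X \<in> I} =
      (\<Union>s\<in>I. {X \<in> split_tables k n u v. heavy_sum k X = s})"
    by auto
  then show ?thesis
    using that by (simp only:) (intro card_UN_disjoint, auto simp: finite_contingency_tables)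
qed

text \<open>Sums above \<open>2 * a\<close> are at least \<open>a\<close> steps into the range of decay, so each of them has
  probability at most \<open>q ^ a\<close> times the number of margin pairs. The square comes from the at most
  \<open>k * u\<close> values in the tail and the bound \<open>k * u\<close> on each.\<close>

lemma mean_heavy_sum_upper:
  assumes "k > 0" "n > 0" "k * u \<le> n * v" "a \<le> k * u" and q: "0 < q" "q < 1"
    and decay: "\<And>s. a \<le> s \<Longrightarrow> s < k * u \<Longrightarrow>
      real (block_count k n u v (s + 1)) \<le> q * real (block_count k n u v s)"
  shows "mean_heavy_sum k n u v \<le> 2 * real a + real (k * u) ^ 2 * margin_pairs_bound k n u v * q ^ a"
proof -
  let ?T = "split_tables k n u v" and ?F = "\<lambda>s. real (block_count k n u v s)"
  let ?E = "margin_pairs_bound k n u v" and ?Z = "real (card (split_tables k n u v))"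
  let ?I = "{2 * a<..k * u}"
  have E: "?E \<ge> 0" by (simp add: margin_pairs_bound_def)
  have F: "?F s \<le> q ^ d * ?F a" if "s = a + d" "s \<le> k * u" for s d
    using that
  proof (induction d arbitrary: s)
    case (Suc d)
    have "?F s \<le> q * ?F (a + d)" using decay[of "a + d"] Suc.prems by simp
    also have "\<dots> \<le> q * (q ^ d * ?F a)" using Suc q by (intro mult_left_mono) auto
    finally show ?case by simp
  qed simp
  have "real (card {X \<in> ?T. heavy_sum k X \<in> ?I}) =
      (\<Sum>s\<in>?I. real (card {X \<in> ?T. heavy_sum k X = s}))"
    by (subst card_heavy_sum_in) auto
  also have "\<dots> \<le> (\<Sum>s\<in>?I. q ^ a * ?E * ?Z)"
  proof (rule sum_mono)
    fix s assume s: "s \<in> ?I"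
    have pos: "?F a > 0" using block_count_pos assms by simp
    have "?F s \<le> q ^ (s - a) * ?F a" using s by (intro F) auto
    also have "\<dots> \<le> q ^ a * ?F a"
      using s q by (intro mult_right_mono power_decreasing) auto
    finally have "?F s / ?F a \<le> q ^ a" using pos by (simp add: field_simps)
    then have "?F s / ?F a * ?E * ?Z \<le> q ^ a * ?E * ?Z"
      using E by (intro mult_right_mono) auto
    moreover have "real (card {X \<in> ?T. heavy_sum k X = s}) \<le> ?F s / ?F a * ?E * ?Z"
      using assms by (intro card_heavy_sum_le_ratio) auto
    ultimately show "real (card {X \<in> ?T. heavy_sum k X = s}) \<le> q ^ a * ?E * ?Z" by linarith
  qed
  also have "\<dots> \<le> real (k * u) * (q ^ a * ?E * ?Z)"
    unfolding sum_constant using E q by (intro mult_right_mono) (auto simp flip: of_nat_mult)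
  finally have tail: "real (card {X \<in> ?T. heavy_sum k X \<in> ?I}) \<le> real (k * u) * (q ^ a * ?E * ?Z)" .
  have "(\<Sum>X\<in>?T. real (heavy_sum k X)) \<le>
      (\<Sum>X\<in>?T. 2 * real a + real (k * u) * of_bool (heavy_sum k X \<in> ?I))"
  proof (rule sum_mono)
    fix X assume "X \<in> ?T"
    then have "heavy_sum k X \<le> k * u" by (rule heavy_sum_le)
    moreover from this have "real (heavy_sum k X) \<le> real (k * u)" by (simp only: of_nat_le_iff)
    ultimately show "real (heavy_sum k X) \<le> 2 * real a + real (k * u) * of_bool (heavy_sum k X \<in> ?I)"
      by (cases "heavy_sum k X \<in> ?I") (auto simp del: of_nat_mult)
  qed
  also have "\<dots> = 2 * real a * ?Z + real (k * u) * real (card {X \<in> ?T. heavy_sum k X \<in> ?I})"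
    by (simp add: sum.distrib sum_distrib_left[symmetric] finite_contingency_tables Int_def conj_commute
       sum_of_bool_eq)
  also have "\<dots> \<le> 2 * real a * ?Z + real (k * u) * (real (k * u) * (q ^ a * ?E * ?Z))"
    using tail by (intro add_left_mono mult_left_mono) auto
  also have "\<dots> = (2 * real a + real (k * u) ^ 2 * ?E * q ^ a) * ?Z"
    by (simp add: algebra_simps power2_eq_square)
  finally show ?thesis
    unfolding mean_heavy_sum_def using card_split_tables_pos[of k n u v]
    by (subst pos_divide_le_eq) auto
qed

text \<open>Dually, sums below \<open>b\<close> are at least \<open>b\<close> steps away from \<open>2 * b\<close>, where the block count is
  larger by the factor \<open>g ^ b\<close>.\<close>

lemma mean_heavy_sum_lower:
  assumes "k > 0" "n > 0" "k * u \<le> n * v" "2 * b \<le> k * u" and g: "1 < g"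
    and growth: "\<And>s. s < 2 * b \<Longrightarrow>
      g * real (block_count k n u v s) \<le> real (block_count k n u v (s + 1))"
  shows "real b * (1 - real b * margin_pairs_bound k n u v * (1 / g) ^ b) \<le> mean_heavy_sum k n u v"
proof -
  let ?T = "split_tables k n u v" and ?F = "\<lambda>s. real (block_count k n u v s)"
  let ?E = "margin_pairs_bound k n u v" and ?Z = "real (card (split_tables k n u v))"
  let ?I = "{..<b}"
  have E: "?E \<ge> 0" by (simp add: margin_pairs_bound_def)
  have F: "g ^ d * ?F s \<le> ?F (s + d)" if "s + d \<le> 2 * b" for s d
    using that
  proof (induction d)
    case (Suc d)
    have "g ^ Suc d * ?F s = g * (g ^ d * ?F s)" by simp
    also have "\<dots> \<le> g * ?F (s + d)" using Suc g by (intro mult_left_mono) auto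
    also have "\<dots> \<le> ?F (s + Suc d)" using growth[of "s + d"] Suc.prems by simp
    finally show ?case .
  qed simp
  have "real (card {X \<in> ?T. heavy_sum k X \<in> ?I}) =
      (\<Sum>s\<in>?I. real (card {X \<in> ?T. heavy_sum k X = s}))"
    by (subst card_heavy_sum_in) auto
  also have "\<dots> \<le> (\<Sum>s\<in>?I. (1 / g) ^ b * ?E * ?Z)"
  proof (rule sum_mono)
    fix s assume s: "s \<in> ?I"
    have pos: "?F (2 * b) > 0" using block_count_pos assms by simp
    have "g ^ b * ?F s \<le> g ^ (2 * b - s) * ?F s"
      using s g by (intro mult_right_mono power_increasing) auto
    also have "\<dots> \<le> ?F (2 * b)" using F[of s "2 * b - s"] s by simp
    finally have "?F s / ?F (2 * b) \<le> (1 / g) ^ b"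
      using pos g by (simp add: field_simps power_divide)
    then have "?F s / ?F (2 * b) * ?E * ?Z \<le> (1 / g) ^ b * ?E * ?Z"
      using E by (intro mult_right_mono) auto
    moreover have "real (card {X \<in> ?T. heavy_sum k X = s}) \<le> ?F s / ?F (2 * b) * ?E * ?Z"
      using assms by (intro card_heavy_sum_le_ratio) auto
    ultimately show "real (card {X \<in> ?T. heavy_sum k X = s}) \<le> (1 / g) ^ b * ?E * ?Z" by linarith
  qed
  finally have tail: "real (card {X \<in> ?T. heavy_sum k X \<in> ?I}) \<le> real b * ((1 / g) ^ b * ?E * ?Z)"
    by simp
  have "real b * (1 - real b * ?E * (1 / g) ^ b) * ?Z = real b * ?Z - real b * (real b * ((1 / g) ^ b * ?E * ?Z))"
    by (simp add: algebra_simps)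
  also have "\<dots> \<le> real b * ?Z - real b * real (card {X \<in> ?T. heavy_sum k X \<in> ?I})"
    using tail by (intro diff_left_mono mult_left_mono) auto
  also have "\<dots> = (\<Sum>X\<in>?T. real b - real b * of_bool (heavy_sum k X \<in> ?I))"
    by (simp add: sum_subtractf sum_distrib_left[symmetric] finite_contingency_tables Int_def
       sum_of_bool_eq mult.commute conj_commute)
  also have "\<dots> \<le> (\<Sum>X\<in>?T. real (heavy_sum k X))"
    by (intro sum_mono) auto
  finally show ?thesis
    unfolding mean_heavy_sum_def using card_split_tables_pos[of k n u v]
    by (subst pos_le_divide_eq) auto
qed

section \<open>Consecutive quotients of the block count\<close>

lemma num_fillings_Suc:
  assumes "a > 0"
  shows "real (num_fillings a (Suc s)) * (real s + 1) = real (num_fillings a s) * (real s + real a)"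
proof -
  have "Suc s * (Suc s + a - 1 choose Suc s) = (Suc s + a - 1) * (Suc s + a - 1 - 1 choose s)"
    by (rule binomial_absorption)
  moreover have "Suc s + a - 1 - 1 = s + a - 1" "Suc s + a - 1 = s + a" using assms by auto
  ultimately have "Suc s * num_fillings a (Suc s) = (s + a) * num_fillings a s"
    by (simp add: num_fillings_def)
  then have "real (Suc s * num_fillings a (Suc s)) = real ((s + a) * num_fillings a s)"
    by (rule arg_cong)
  then show ?thesis by (simp add: algebra_simps)
qed

lemma block_count_Suc:
  assumes "k > 0" "n > 0" "k * u \<le> n * v" "s < k * u"
  defines "x \<equiv> real (k * u) - real s" and "y \<equiv> real (n * v) - real (k * u) + real s"
  shows "real (block_count k n u v (s + 1)) = real (block_count k n u v s) *
    ((real s + real k ^ 2) / (real s + 1) * (x / (x + real (k * n) - 1)) ^ 2 *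
     ((y + real n ^ 2) / (y + 1)))"
proof -
  \<comment> \<open>The sums of the mixed blocks decrease from \<open>t + 1\<close> to \<open>t\<close>.\<close>
  define t where "t = k * u - s - 1"
  have t: "k * u - s = Suc t" "k * u - (s + 1) = t" using assms by (auto simp: t_def)
  have x: "x = real t + 1" using assms(4) unfolding x_def t_def by linarith
  have y: "real (n * v - k * u + s) = y" using assms(3) unfolding y_def by (simp add: of_nat_diff)
  have kn: "real (k * n) \<ge> 1" using assms(1,2) by (simp flip: of_nat_mult add: Suc_le_eq)
  have y0: "y \<ge> 0" using y by linarith
  have A: "real (num_fillings (k * k) (s + 1)) =
      real (num_fillings (k * k) s) * ((real s + real k ^ 2) / (real s + 1))"
    using num_fillings_Suc[of "k * k" s] assms(1) by (simp add: field_simps power2_eq_square)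
  have B: "real (num_fillings (k * n) t) =
      real (num_fillings (k * n) (k * u - s)) * (x / (x + real (k * n) - 1))"
    using num_fillings_Suc[of "k * n" t] assms(1,2) kn unfolding t x by (simp add: field_simps)
  have C: "real (num_fillings (n * n) (n * v - k * u + s + 1)) =
      real (num_fillings (n * n) (n * v - k * u + s)) * ((y + real n ^ 2) / (y + 1))"
    using num_fillings_Suc[of "n * n" "n * v - k * u + s"] assms(2) y0 unfolding y
    by (simp add: field_simps power2_eq_square)
  show ?thesis
    unfolding block_count_def t(2) of_nat_mult of_nat_power add.assoc[symmetric] A B C
    by (simp only: power_mult_distrib mult_ac)
qed

text \<open>Each of the three factors of the quotient is replaced by a bound that does not depend
  on \<open>s\<close>. For large \<open>n\<close> the bound tends to
  \<open>(1 + 1 / A) * (B C / (B C + 1))\<^sup>2 * (1 + 1 / C)\<close>.\<close>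

lemma block_count_decay:
  assumes "k > 0" "n > 1" "k * u < n * v" "A > 0" "A * k ^ 2 \<le> s" "s < k * u"
  shows "real (block_count k n u v (s + 1)) \<le>
    ((1 + 1 / real A) * (real u / (real u + real n - 1)) ^ 2 *
     (1 + real n ^ 2 / (real (n * v) - real (k * u)))) * real (block_count k n u v s)"
proof -
  define x where "x = real (k * u) - real s"
  define w where "w = real (n * v) - real (k * u)"
  have w: "w > 0" using assms(3) unfolding w_def by linarith
  have x: "x > 0" using assms(6) unfolding x_def by linarith
  have k1: "real k \<ge> 1" and n1: "real n > 1" using assms by auto
  have n0: "n > 0" using assms(2) by simp
  have u: "u > 0" using assms by (cases u) auto
  have kk: "real A * real k ^ 2 \<le> real s"
    using assms(5) by (metis of_nat_le_iff of_nat_mult of_nat_power)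
  have "real k ^ 2 \<le> real s / real A" using kk assms(4) by (simp add: field_simps)
  then have 1: "(real s + real k ^ 2) / (real s + 1) \<le> 1 + 1 / real A"
    by (simp add: divide_simps) (use assms(4) in \<open>simp add: field_simps\<close>)
  have xk: "x \<le> real k * real u" unfolding x_def by simp
  have "x * (real u + real n - 1) \<le> real u * (x + real (k * n) - 1)"
  proof -
    have "x * (real n - 1) \<le> real k * real u * (real n - 1)"
      using xk n1 by (intro mult_right_mono) auto
    also have "\<dots> \<le> real u * (real (k * n) - 1)"
      using mult_right_mono[OF k1, of "real u"] by (simp add: algebra_simps)
    finally show ?thesis by (simp add: algebra_simps)
  qed
  moreover have "x + real (k * n) - 1 > 0"
    using x k1 n1 mult_mono[of 1 "real k" 1 "real n"] by simp
  ultimately have 2: "x / (x + real (k * n) - 1) \<le> real u / (real u + real n - 1)"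
    using n1 by (simp add: frac_le_eq divide_le_0_iff)
  have 3: "(w + real s + real n ^ 2) / (w + real s + 1) \<le> 1 + real n ^ 2 / w"
  proof -
    have "(w + real s + real n ^ 2) / (w + real s + 1) \<le> (w + real s + real n ^ 2) / (w + real s)"
      using w by (intro divide_left_mono) (auto intro: add_nonneg_nonneg)
    also have "\<dots> = 1 + real n ^ 2 / (w + real s)" using w by (simp add: field_simps)
    also have "\<dots> \<le> 1 + real n ^ 2 / w" using w by (intro add_left_mono divide_left_mono) auto
    finally show ?thesis .
  qed
  have x2: "(x / (x + real (k * n) - 1)) ^ 2 \<le> (real u / (real u + real n - 1)) ^ 2"
    using 2 x \<open>x + real (k * n) - 1 > 0\<close> by (intro power_mono) auto
  have "(real s + real k ^ 2) / (real s + 1) * (x / (x + real (k * n) - 1)) ^ 2 *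
     ((w + real s + real n ^ 2) / (w + real s + 1)) \<le>
     (1 + 1 / real A) * (real u / (real u + real n - 1)) ^ 2 * (1 + real n ^ 2 / w)"
    using w assms(4) by (intro mult_mono 1 x2 3) (auto intro!: mult_nonneg_nonneg divide_nonneg_nonneg)
  then show ?thesis
    unfolding block_count_Suc[OF assms(1) n0 less_imp_le[OF assms(3)] assms(6)]
      x_def[symmetric] w_def[symmetric]
    by (subst mult.commute) (intro mult_left_mono, auto)
qed

text \<open>Here \<open>L\<close> bounds the first factor of the quotient from below: the value 1 is always allowed, and larger
  values are allowed if \<open>M\<close> is small compared with \<open>k\<^sup>2\<close>.\<close>

lemma block_count_growth:
  assumes "k > 0" "n > 0" "k * u \<le> n * v" "s < M"
    and M: "real M \<le> e * real k * real n" "e * real n < real u"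
    and L: "0 \<le> L" "L \<le> max 1 (real k ^ 2 / real M)"
  shows "(L * ((real u - e * real n) / (real u - e * real n + real n)) ^ 2 *
     (1 + (real n ^ 2 - 1) / (real (n * v) + 1))) * real (block_count k n u v s)
     \<le> real (block_count k n u v (s + 1))"
proof -
  define x where "x = real (k * u) - real s"
  define y where "y = real (n * v) - real (k * u) + real s"
  have k1: "real k \<ge> 1" and n1: "real n \<ge> 1" using assms by auto
  have "real M < real (k * u)"
  proof -
    have "e * real k * real n = real k * (e * real n)" by simp
    also have "\<dots> < real k * real u" using M(2) k1 by (intro mult_strict_left_mono) auto
    finally show ?thesis using M(1) by simp
  qed
  then have s: "s < k * u" using assms(4) by linarith
  have y0: "y \<ge> 0" using assms(3) unfolding y_def by (simp flip: of_nat_mult)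
  have yv: "y \<le> real (n * v)" using s unfolding y_def by linarith
  have sM: "real s + 1 \<le> real M" using assms(4) by linarith
  have M0: "real M > 0" using assms(4) by simp
  have 1: "L \<le> (real s + real k ^ 2) / (real s + 1)"
  proof -
    have "1 \<le> (real s + real k ^ 2) / (real s + 1)"
      using k1 by (simp add: field_simps)
    moreover have "real k ^ 2 / real M \<le> (real s + real k ^ 2) / (real s + 1)"
      using sM by (intro frac_le) auto
    ultimately show ?thesis using L(2) by linarith
  qed
  define z where "z = real u - e * real n"
  have z: "z > 0" using M(2) by (simp add: z_def)
  have xz: "real k * z \<le> x"
    using M(1) assms(4) unfolding x_def z_def by (simp add: algebra_simps)
  have x: "x > 0" using xz z k1 by (smt (verit) mult_pos_pos)
  have kn: "real (k * n) \<ge> 1" using k1 n1 mult_mono[of 1 "real k" 1 "real n"] by simp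
  have "z * (x + real (k * n) - 1) \<le> x * (z + real n)"
  proof -
    have "z * (real (k * n) - 1) \<le> z * real (k * n)" using z by (intro mult_left_mono) auto
    also have "\<dots> = (real k * z) * real n" by simp
    also have "\<dots> \<le> x * real n" using xz by (intro mult_right_mono) auto
    finally show ?thesis by (simp add: algebra_simps)
  qed
  then have 2: "z / (z + real n) \<le> x / (x + real (k * n) - 1)"
    using x z kn n1 by (simp add: field_simps)
  have 3: "1 + (real n ^ 2 - 1) / (real (n * v) + 1) \<le> (y + real n ^ 2) / (y + 1)"
  proof -
    have "(y + real n ^ 2) / (y + 1) = 1 + (real n ^ 2 - 1) / (y + 1)"
      using y0 by (simp add: field_simps)
    moreover have "(real n ^ 2 - 1) / (real (n * v) + 1) \<le> (real n ^ 2 - 1) / (y + 1)"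
      using yv y0 n1 by (intro divide_left_mono) auto
    ultimately show ?thesis by linarith
  qed
  have "L * (z / (z + real n)) ^ 2 * (1 + (real n ^ 2 - 1) / (real (n * v) + 1)) \<le>
    (real s + real k ^ 2) / (real s + 1) * (x / (x + real (k * n) - 1)) ^ 2 *
     ((y + real n ^ 2) / (y + 1))"
  proof (intro mult_mono power_mono 1 2 3)
    have "real n ^ 2 \<ge> 1" using n1 by simp
    then show "0 \<le> 1 + (real n ^ 2 - 1) / (real (n * v) + 1)" by simp
  qed (use x z kn L in auto)
  then show ?thesis
    unfolding block_count_Suc[OF assms(1-3) s] x_def[symmetric] y_def[symmetric] z_def[symmetric]
    by (subst mult.commute) (intro mult_left_mono, auto)
qed

section \<open>Asymptotics\<close>

text \<open>Clearing denominators turns the claim into \<open>(B - 1)\<^sup>2 < 1 + 1 / C\<close>.\<close>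

lemma subcritical_ratio:
  fixes B C :: real
  assumes "B > 0" "C > 0" "B < critical_B C"
  shows "(B * C / (B * C + 1)) ^ 2 * (1 + 1 / C) < 1"
proof -
  have "(B - 1) ^ 2 < 1 + 1 / C"
  proof (cases "B \<ge> 1")
    case True
    then have "(B - 1) ^ 2 < sqrt (1 + 1 / C) ^ 2"
      using assms by (intro power_strict_mono) (auto simp: critical_B_def)
    then show ?thesis using assms(2) by simp
  next
    case False
    then have "(B - 1) ^ 2 < 1" using assms(1) by (simp add: power2_less_1_iff abs_less_iff)
    then show ?thesis using assms(2) by (smt (verit) divide_pos_pos)
  qed
  then have "C * (B - 1) ^ 2 < C + 1" using assms(2) by (simp add: field_simps)
  then have "C * (C * (B - 1) ^ 2) < C * (C + 1)" using assms(2) by simp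
  then have "(B * C) ^ 2 * (C + 1) < C * (B * C + 1) ^ 2"
    by (simp add: power2_eq_square algebra_simps)
  moreover have "B * C + 1 > 0" using assms by (simp add: add_pos_pos)
  ultimately show ?thesis using assms(2) by (simp add: field_simps power_divide)
qed

lemma supercritical_ratio:
  fixes B C :: real
  assumes "C > 0" "B > critical_B C"
  shows "(B * C / (B * C + 1)) ^ 2 * (1 + 1 / C) > 1"
proof -
  have B: "B > 1" using assms unfolding critical_B_def by (smt (verit) divide_pos_pos real_sqrt_ge_zero)
  have "sqrt (1 + 1 / C) ^ 2 < (B - 1) ^ 2"
    using assms by (intro power_strict_mono) (auto simp: critical_B_def)
  then have "1 + 1 / C < (B - 1) ^ 2" using assms(1) by simp
  then have "C + 1 < C * (B - 1) ^ 2" using assms(1) by (simp add: field_simps)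
  then have "C * (C + 1) < C * (C * (B - 1) ^ 2)" using assms(1) by simp
  then have "C * (B * C + 1) ^ 2 < (B * C) ^ 2 * (C + 1)"
    by (simp add: power2_eq_square algebra_simps)
  moreover have "B * C + 1 > 0" using assms B by (simp add: add_pos_pos)
  ultimately show ?thesis using assms(1) by (simp add: field_simps power_divide)
qed

lemma divide_le_cross:
  fixes x y x' y' :: real
  assumes "0 < y" "0 < y'" "x * y' \<le> x' * y"
  shows "x / y \<le> x' / y'"
  using assms by (simp add: field_simps)

lemma nat_floor_bounds:
  fixes x :: real
  assumes "x \<ge> 0"
  shows "real (nat \<lfloor>x\<rfloor>) \<le> x" "x - 1 \<le> real (nat \<lfloor>x\<rfloor>)"
  using assms by linarith+

lemma num_heavy_le: "real (num_heavy \<delta> n) \<le> real n powr \<delta>"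
  unfolding num_heavy_def by (intro nat_floor_bounds) simp

context
  fixes B C \<delta> :: real
  assumes B: "B > 0" and C: "C > 0" and \<delta>: "1 / 2 < \<delta>" "\<delta> < 1"
begin

definition heavy_margin :: "nat \<Rightarrow> nat" where "heavy_margin n = nat \<lfloor>B * C * real n\<rfloor>"
definition light_margin :: "nat \<Rightarrow> nat" where "light_margin n = nat \<lfloor>C * real n\<rfloor>"

lemma BC: "B * C > 0" using B C by simp

lemma heavy_margin_bounds:
  "real (heavy_margin n) \<le> B * C * real n" "B * C * real n - 1 \<le> real (heavy_margin n)"
  unfolding heavy_margin_def using BC by (intro nat_floor_bounds; simp)+

lemma light_margin_bounds:
  "real (light_margin n) \<le> C * real n" "C * real n - 1 \<le> real (light_margin n)"
  unfolding light_margin_def using C by (intro nat_floor_bounds; simp)+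

lemma num_heavy_ge: "\<forall>\<^sub>F n in sequentially. real n powr \<delta> / 2 \<le> real (num_heavy \<delta> n)"
proof -
  have "\<forall>\<^sub>F n in sequentially. real n powr \<delta> \<ge> 2" using \<delta> by real_asymp
  then show ?thesis
  proof eventually_elim
    case (elim n)
    have "real n powr \<delta> - 1 \<le> real (num_heavy \<delta> n)"
      unfolding num_heavy_def by (intro nat_floor_bounds) simp
    then show ?case using elim by linarith
  qed
qed

lemma num_heavy_at_top: "filterlim (\<lambda>n. real (num_heavy \<delta> n)) at_top sequentially"
  by (rule filterlim_at_top_mono[OF _ num_heavy_ge]) (use \<delta> in real_asymp)

lemma num_heavy_eventually_le:
  assumes "e > 0"
  shows "\<forall>\<^sub>F n in sequentially. real (num_heavy \<delta> n) \<le> e * real n"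
proof -
  have "\<forall>\<^sub>F n in sequentially. real n powr \<delta> \<le> e * real n" using \<delta> assms by real_asymp
  then show ?thesis
    by eventually_elim (use num_heavy_le order_trans in blast)
qed

lemma light_dominates:
  "\<forall>\<^sub>F n in sequentially. num_heavy \<delta> n * heavy_margin n < n * light_margin n"
proof -
  have "\<forall>\<^sub>F n in sequentially. real n powr \<delta> * (B * C * real n) < real n * (C * real n - 1)"
    using \<delta> B C by real_asymp
  then show ?thesis
  proof eventually_elim
    case (elim n)
    have "real (num_heavy \<delta> n) * real (heavy_margin n) \<le> real n powr \<delta> * (B * C * real n)"
      using num_heavy_le heavy_margin_bounds by (intro mult_mono) auto
    also note elim
    also have "real n * (C * real n - 1) \<le> real n * real (light_margin n)"
      using light_margin_bounds by (intro mult_left_mono) auto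
    finally show ?case by (simp only: of_nat_mult[symmetric] of_nat_less_iff)
  qed
qed

abbreviation "pairs_bound n \<equiv> margin_pairs_bound (num_heavy \<delta> n) n (heavy_margin n) (light_margin n)"

text \<open>The number of margin pairs is \<open>exp (O(n log n))\<close>. Since \<open>2 * \<delta> > 1\<close>, this is
  absorbed by \<open>q ^ f n\<close>; the power of \<open>n\<close> leaves room for the polynomial factors in the bounds
  on the mean.\<close>

lemma margin_pairs_negligible:
  fixes f :: "nat \<Rightarrow> nat"
  assumes q: "0 < q" "q < 1" and c: "c > 0"
    and f: "\<forall>\<^sub>F n in sequentially. c * real n powr (2 * \<delta>) \<le> real (f n)"
  shows "(\<lambda>n. real n ^ 6 * pairs_bound n * q ^ f n) \<longlonglongrightarrow> 0"
proof -
  define l where "l = - (ln q * c)"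
  have l: "l > 0" using q c by (simp add: l_def mult_neg_pos)
  define a where "a = 2 * \<delta>"
  have a: "a > 1" using \<delta> by (simp add: a_def)
  have lim: "(\<lambda>n. real n ^ 6 * exp (12 * real n * ln (real n)) * exp (- (l * real n powr a))) \<longlonglongrightarrow> 0"
    using l a by real_asymp
  have size: "\<forall>\<^sub>F n in sequentially. real n * (B * C * real n) + real n * (C * real n) + 1 \<le> real n ^ 3"
    using B C by real_asymp
  have upper: "\<forall>\<^sub>F n in sequentially. real n ^ 6 * pairs_bound n * q ^ f n \<le>
      real n ^ 6 * exp (12 * real n * ln (real n)) * exp (- (l * real n powr a))"
    using size f num_heavy_eventually_le[of 1, simplified] eventually_gt_at_top[of 0]
  proof eventually_elim
    case (elim n)
    have k: "num_heavy \<delta> n \<le> n" using elim(3) by simp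
    have "real (num_heavy \<delta> n * heavy_margin n + n * light_margin n + 1) \<le>
        real n * (B * C * real n) + real n * (C * real n) + 1"
      unfolding of_nat_add of_nat_mult using k heavy_margin_bounds light_margin_bounds
      by (intro add_mono mult_mono) auto
    also note elim(1)
    finally have base: "real (num_heavy \<delta> n * heavy_margin n + n * light_margin n + 1) \<le> real n ^ 3" .
    have "pairs_bound n \<le> (real n ^ 3) ^ (2 * (num_heavy \<delta> n + n))"
      unfolding margin_pairs_bound_def by (rule power_mono[OF base]) simp
    also have "\<dots> \<le> (real n ^ 3) ^ (4 * n)"
      using k elim(4) by (intro power_increasing) auto
    also have "\<dots> = exp (12 * real n * ln (real n))"
    proof -
      have "(real n ^ 3) ^ (4 * n) = real n ^ (12 * n)" by (simp flip: power_mult)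
      also have "\<dots> = exp (real (12 * n) * ln (real n))"
        using elim(4) by (subst exp_of_nat_mult) simp
      finally show ?thesis by (simp add: mult.assoc)
    qed
    finally have 1: "pairs_bound n \<le> exp (12 * real n * ln (real n))" .
    have "q ^ f n = exp (real (f n) * ln q)"
      using q by (subst exp_of_nat_mult) simp
    also have "real (f n) * ln q \<le> (c * real n powr a) * ln q"
      using elim(2) q by (intro mult_right_mono_neg) (auto simp: a_def)
    also have "\<dots> = - (l * real n powr a)" by (simp add: l_def)
    finally have 2: "q ^ f n \<le> exp (- (l * real n powr a))" by simp
    show ?case
      using q by (intro mult_mono 1 2 mult_nonneg_nonneg) (auto simp: margin_pairs_bound_def)
  qed
  have lower: "\<forall>\<^sub>F n in sequentially. 0 \<le> real n ^ 6 * pairs_bound n * q ^ f n"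
    using q by (intro always_eventually allI mult_nonneg_nonneg) (auto simp: margin_pairs_bound_def)
  show ?thesis
    by (rule tendsto_sandwich[OF lower upper tendsto_const lim])
qed

abbreviation "mean_heavy n \<equiv> mean_heavy_sum (num_heavy \<delta> n) n (heavy_margin n) (light_margin n)"

lemma decay_factor:
  assumes "A > 0" and "(1 + 1 / real A) * ((B * C / (B * C + 1)) ^ 2 * (1 + 1 / C)) < q"
  shows "\<forall>\<^sub>F n in sequentially.
    (1 + 1 / real A) * (real (heavy_margin n) / (real (heavy_margin n) + real n - 1)) ^ 2 *
     (1 + real n ^ 2 / (real (n * light_margin n) - real (num_heavy \<delta> n * heavy_margin n))) \<le> q"
proof -
  define D where "D = B * C"
  have D: "D > 0" using BC by (simp add: D_def)
  \<comment> \<open>A closed-form lower bound for \<open>n * v - k * u\<close>.\<close>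
  define low where "low = (\<lambda>n. real n * (C * real n - 1) - real n powr \<delta> * (D * real n))"
  have "(\<lambda>n. (1 + 1 / real A) * (D * real n / (D * real n + real n - 1)) ^ 2 * (1 + real n ^ 2 / low n))
     \<longlonglongrightarrow> (1 + 1 / real A) * (D / (D + 1)) ^ 2 * (1 + 1 / C)"
  proof (intro tendsto_mult tendsto_power tendsto_add tendsto_const)
    show "(\<lambda>n. D * real n / (D * real n + real n - 1)) \<longlonglongrightarrow> D / (D + 1)"
      using D by (real_asymp simp: field_simps)
    show "(\<lambda>n. real n ^ 2 / low n) \<longlonglongrightarrow> 1 / C"
      unfolding low_def using D C \<delta> by (real_asymp simp: field_simps)
  qed
  then have lim: "\<forall>\<^sub>F n in sequentially.
      (1 + 1 / real A) * (D * real n / (D * real n + real n - 1)) ^ 2 * (1 + real n ^ 2 / low n) < q"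
    using assms(2) by (intro order_tendstoD(2)[of _ "(1 + 1 / real A) * (D / (D + 1)) ^ 2 * (1 + 1 / C)"])
      (auto simp: D_def mult.assoc)
  have low_pos: "\<forall>\<^sub>F n in sequentially. low n > 0"
    unfolding low_def using D C \<delta> by real_asymp
  show ?thesis
    using lim low_pos eventually_gt_at_top[of 1]
  proof eventually_elim
    case (elim n)
    let ?u = "real (heavy_margin n)"
    have u: "?u \<le> D * real n" using heavy_margin_bounds by (simp add: D_def)
    have "?u * (real n - 1) \<le> (D * real n) * (real n - 1)"
      using u elim(3) by (intro mult_right_mono) auto
    then have "?u * (D * real n + real n - 1) \<le> (D * real n) * (?u + real n - 1)"
      by (simp add: algebra_simps)
    moreover have "?u + real n - 1 > 0" "D * real n + real n - 1 > 0"
      using elim(3) D by (auto intro: add_nonneg_pos simp: add_diff_eq[symmetric])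
    ultimately have 1: "?u / (?u + real n - 1) \<le> D * real n / (D * real n + real n - 1)"
      by (intro divide_le_cross)
    have "real (num_heavy \<delta> n) * ?u \<le> real n powr \<delta> * (D * real n)"
      using num_heavy_le u by (intro mult_mono) auto
    moreover have "real n * (C * real n - 1) \<le> real n * real (light_margin n)"
      using light_margin_bounds by (intro mult_left_mono) auto
    ultimately have w: "low n \<le> real (n * light_margin n) - real (num_heavy \<delta> n * heavy_margin n)"
      unfolding low_def of_nat_mult by linarith
    have 2: "1 + real n ^ 2 / (real (n * light_margin n) - real (num_heavy \<delta> n * heavy_margin n))
       \<le> 1 + real n ^ 2 / low n"
      using w elim(2) by (intro add_left_mono divide_left_mono mult_pos_pos) auto
    have "(1 + 1 / real A) * (?u / (?u + real n - 1)) ^ 2 *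
       (1 + real n ^ 2 / (real (n * light_margin n) - real (num_heavy \<delta> n * heavy_margin n)))
      \<le> (1 + 1 / real A) * (D * real n / (D * real n + real n - 1)) ^ 2 * (1 + real n ^ 2 / low n)"
      using 1 2 w elim(2,3) \<open>?u + real n - 1 > 0\<close>
      by (intro mult_mono power_mono) (auto intro!: mult_nonneg_nonneg add_nonneg_nonneg)
    then show ?case using elim(1) by linarith
  qed
qed

lemma growth_factor:
  assumes e: "0 < e" "e < B * C" and L: "L \<ge> 0"
    and g: "g < L * ((B * C - e) / (B * C - e + 1)) ^ 2 * (1 + 1 / C)"
  shows "\<forall>\<^sub>F n in sequentially. e * real n < real (heavy_margin n) \<and>
    g \<le> L * ((real (heavy_margin n) - e * real n) / (real (heavy_margin n) - e * real n + real n)) ^ 2 *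
     (1 + (real n ^ 2 - 1) / (real (n * light_margin n) + 1))"
proof -
  define D where "D = B * C - e"
  have D: "D > 0" using e by (simp add: D_def)
  have "(\<lambda>n. L * ((D * real n - 1) / (D * real n - 1 + real n)) ^ 2 *
      (1 + (real n ^ 2 - 1) / (C * real n ^ 2 + 1)))
     \<longlonglongrightarrow> L * (D / (D + 1)) ^ 2 * (1 + 1 / C)"
  proof (intro tendsto_mult tendsto_power tendsto_add tendsto_const)
    show "(\<lambda>n. (D * real n - 1) / (D * real n - 1 + real n)) \<longlonglongrightarrow> D / (D + 1)"
      using D by (real_asymp simp: field_simps)
    show "(\<lambda>n. (real n ^ 2 - 1) / (C * real n ^ 2 + 1)) \<longlonglongrightarrow> 1 / C"
      using C by (real_asymp simp: field_simps)
  qed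
  then have lim: "\<forall>\<^sub>F n in sequentially.
      g < L * ((D * real n - 1) / (D * real n - 1 + real n)) ^ 2 *
      (1 + (real n ^ 2 - 1) / (C * real n ^ 2 + 1))"
    by (rule order_tendstoD(1)) (use g in \<open>simp add: D_def\<close>)
  have pos: "\<forall>\<^sub>F n in sequentially. D * real n - 1 > 0" using D by real_asymp
  show ?thesis
    using lim pos eventually_gt_at_top[of 0]
  proof eventually_elim
    case (elim n)
    define z where "z = real (heavy_margin n) - e * real n"
    have z: "D * real n - 1 \<le> z"
      using heavy_margin_bounds(2)[of n] by (simp add: z_def D_def algebra_simps)
    have "(D * real n - 1) * real n \<le> z * real n" using z by (intro mult_right_mono) auto
    then have 1: "(D * real n - 1) / (D * real n - 1 + real n) \<le> z / (z + real n)"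
      using z elim(2,3) by (intro divide_le_cross) (auto simp: algebra_simps)
    have "real n * real (light_margin n) \<le> real n * (C * real n)"
      using light_margin_bounds by (intro mult_left_mono) auto
    then have "real (n * light_margin n) + 1 \<le> C * real n ^ 2 + 1"
      by (simp add: power2_eq_square algebra_simps)
    then have 2: "(real n ^ 2 - 1) / (C * real n ^ 2 + 1) \<le> (real n ^ 2 - 1) / (real (n * light_margin n) + 1)"
      using elim(3) C by (intro divide_left_mono mult_pos_pos) (auto intro: add_nonneg_pos)
    have n2: "real n ^ 2 - 1 \<ge> 0" using elim(3) by simp
    have "L * ((D * real n - 1) / (D * real n - 1 + real n)) ^ 2 *
      (1 + (real n ^ 2 - 1) / (C * real n ^ 2 + 1)) \<le>
      L * (z / (z + real n)) ^ 2 * (1 + (real n ^ 2 - 1) / (real (n * light_margin n) + 1))"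
      using 1 2 L C n2 z elim(2,3)
      by (intro mult_mono power_mono add_left_mono) (auto intro!: add_nonneg_nonneg divide_nonneg_nonneg)
    then show ?case using elim(1,2) z by (auto simp: z_def)
  qed
qed


text \<open>With \<open>r < 1\<close> the limiting quotient, choose \<open>A\<close> so large that \<open>(1 + 1 / A) * r\<close> is still
  below 1: the block count then decays beyond \<open>A * k\<^sup>2\<close>.\<close>

lemma mean_upper:
  assumes "B < critical_B C"
  shows "\<exists>c. \<forall>\<^sub>F n in sequentially. mean_heavy n \<le> c * real (num_heavy \<delta> n) ^ 2"
proof -
  let ?k = "\<lambda>n. num_heavy \<delta> n"
  define r where "r = (B * C / (B * C + 1)) ^ 2 * (1 + 1 / C)"
  have r: "r < 1" using subcritical_ratio[OF B C assms] by (simp add: r_def)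
  have "(\<lambda>A. (1 + 1 / real A) * r) \<longlonglongrightarrow> (1 + 0) * r"
    by (intro tendsto_intros lim_1_over_n)
  then have "\<forall>\<^sub>F A in sequentially. (1 + 1 / real A) * r < 1"
    using r by (intro order_tendstoD(2)) auto
  then have "\<forall>\<^sub>F A in sequentially. A > 0 \<and> (1 + 1 / real A) * r < 1"
    using eventually_gt_at_top[of 0] by eventually_elim auto
  then obtain A where A: "A > 0" "(1 + 1 / real A) * r < 1"
    using eventually_happens'[OF sequentially_bot] by blast
  obtain q where q: "0 < q" "q < 1" "(1 + 1 / real A) * r < q"
    using dense[of "max 0 ((1 + 1 / real A) * r)" 1] A(2) by auto
  let ?a = "\<lambda>n. A * ?k n ^ 2"
  have "\<forall>\<^sub>F n in sequentially. (1 / 4) * real n powr (2 * \<delta>) \<le> real (?a n)"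
    using num_heavy_ge
  proof eventually_elim
    case (elim n)
    have "(real n powr \<delta> / 2) ^ 2 \<le> real (?k n) ^ 2" using elim by (intro power_mono) auto
    also have "\<dots> \<le> real A * real (?k n) ^ 2" using A(1) mult_right_mono[of 1 "real A" "real (?k n) ^ 2"] by simp
    finally show ?case by (simp add: power2_eq_square powr_add[symmetric])
  qed
  then have "(\<lambda>n. real n ^ 6 * pairs_bound n * q ^ ?a n) \<longlonglongrightarrow> 0"
    using q by (intro margin_pairs_negligible[where c = "1 / 4"]) auto
  then have small: "\<forall>\<^sub>F n in sequentially. real n ^ 6 * pairs_bound n * q ^ ?a n < 1"
    by (intro order_tendstoD(2)) auto
  have u_le: "\<forall>\<^sub>F n in sequentially. B * C * real n \<le> real n ^ 2"
    using BC by real_asymp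
  have k_pos: "\<forall>\<^sub>F n in sequentially. 1 \<le> real (?k n)"
    using num_heavy_at_top unfolding filterlim_at_top by blast
  have a_le: "\<forall>\<^sub>F n in sequentially. ?a n \<le> ?k n * heavy_margin n"
  proof -
    have "\<forall>\<^sub>F n in sequentially. real A * real n powr \<delta> \<le> B * C * real n - 1"
      using BC \<delta> by real_asymp
    then show ?thesis
    proof eventually_elim
      case (elim n)
      have "real A * real (?k n) \<le> real A * real n powr \<delta>"
        using num_heavy_le by (intro mult_left_mono) auto
      then have "real A * real (?k n) \<le> real (heavy_margin n)"
        using elim heavy_margin_bounds(2)[of n] by linarith
      then have "A * ?k n \<le> heavy_margin n"
        by (simp flip: of_nat_mult)
      then show ?case by (simp add: power2_eq_square mult.left_commute)
    qed
  qed
  have "\<forall>\<^sub>F n in sequentially. mean_heavy n \<le> (2 * real A + 1) * real (?k n) ^ 2"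
    using decay_factor[OF A(1) q(3)[unfolded r_def]] small u_le k_pos a_le light_dominates
      num_heavy_eventually_le[of 1, simplified] eventually_gt_at_top[of 1]
  proof eventually_elim
    case (elim n)
    have "mean_heavy n \<le> 2 * real (?a n) + real (?k n * heavy_margin n) ^ 2 * pairs_bound n * q ^ ?a n"
    proof (rule mean_heavy_sum_upper)
      fix s assume s: "?a n \<le> s" "s < ?k n * heavy_margin n"
      have "real (block_count (?k n) n (heavy_margin n) (light_margin n) (s + 1)) \<le>
        (1 + 1 / real A) * (real (heavy_margin n) / (real (heavy_margin n) + real n - 1)) ^ 2 *
        (1 + real n ^ 2 / (real (n * light_margin n) - real (num_heavy \<delta> n * heavy_margin n))) *
        real (block_count (?k n) n (heavy_margin n) (light_margin n) s)"
        using elim A s by (intro block_count_decay) auto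
      also have "\<dots> \<le> q * real (block_count (?k n) n (heavy_margin n) (light_margin n) s)"
        using elim(1) by (rule mult_right_mono) simp
      finally show "real (block_count (?k n) n (heavy_margin n) (light_margin n) (s + 1)) \<le>
        q * real (block_count (?k n) n (heavy_margin n) (light_margin n) s)" .
    qed (use elim q in auto)
    also have "real (?k n * heavy_margin n) ^ 2 * pairs_bound n * q ^ ?a n \<le> real n ^ 6 * pairs_bound n * q ^ ?a n"
    proof -
      have "real (?k n * heavy_margin n) \<le> real n * real n ^ 2"
        unfolding of_nat_mult
      proof (intro mult_mono)
        show "real (heavy_margin n) \<le> real n ^ 2"
          using elim(3) heavy_margin_bounds(1)[of n] by linarith
      qed (use elim(7) in auto)
      then have "real (?k n * heavy_margin n) ^ 2 \<le> (real n * real n ^ 2) ^ 2"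
        by (intro power_mono) auto
      also have "\<dots> = real n ^ 6" by (simp add: power_mult_distrib flip: power_mult power_add)
      finally show ?thesis
        using q by (intro mult_right_mono) (auto simp: margin_pairs_bound_def)
    qed
    also have "real n ^ 6 * pairs_bound n * q ^ ?a n \<le> real (?k n) ^ 2"
      using elim(2) one_le_power[OF elim(4), of 2] by linarith
    finally show ?case by (simp add: algebra_simps)
  qed
  then show ?thesis by blast
qed

text \<open>Both lower bounds arise from the same argument for a range of growth \<open>2 * b n\<close>. It is capped by
  \<open>e * k * n\<close>, so that heavy-by-light entries keep mean at least \<open>B * C - e\<close> throughout the
  range; \<open>L\<close> measures the help from the factor \<open>1 + k\<^sup>2 / s\<close>.\<close>

lemma mean_lower:
  fixes b :: "nat \<Rightarrow> nat"
  assumes e: "0 < e" "e < B * C" and L: "L \<ge> 0"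
    and L1: "1 < L * ((B * C - e) / (B * C - e + 1)) ^ 2 * (1 + 1 / C)"
    and c: "c > 0"
    and b: "\<forall>\<^sub>F n in sequentially. c * real n powr (2 * \<delta>) \<le> real (b n)"
      "\<forall>\<^sub>F n in sequentially. real (2 * b n) \<le> e * real (num_heavy \<delta> n) * real n"
      "\<forall>\<^sub>F n in sequentially. L \<le> max 1 (real (num_heavy \<delta> n) ^ 2 / real (2 * b n))"
  shows "\<forall>\<^sub>F n in sequentially. real (b n) / 2 \<le> mean_heavy n"
proof -
  let ?k = "\<lambda>n. num_heavy \<delta> n"
  obtain g where g: "1 < g" "g < L * ((B * C - e) / (B * C - e + 1)) ^ 2 * (1 + 1 / C)"
    using dense[OF L1] by blast
  have "(\<lambda>n. real n ^ 6 * pairs_bound n * (1 / g) ^ b n) \<longlonglongrightarrow> 0"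
    using g c b(1) by (intro margin_pairs_negligible) auto
  then have small: "\<forall>\<^sub>F n in sequentially. real n ^ 6 * pairs_bound n * (1 / g) ^ b n < 1 / 2"
    by (intro order_tendstoD(2)) auto
  have k_pos: "\<forall>\<^sub>F n in sequentially. 1 \<le> real (?k n)"
    using num_heavy_at_top unfolding filterlim_at_top by blast
  have en: "\<forall>\<^sub>F n in sequentially. e * real n ^ 2 \<le> real n ^ 6"
    using e by real_asymp
  show ?thesis
    using growth_factor[OF e L g(2)] small k_pos en b(2,3) light_dominates
      num_heavy_eventually_le[of 1, simplified] eventually_gt_at_top[of 0]
  proof eventually_elim
    case (elim n)
    have "real (2 * b n) \<le> real (?k n) * (e * real n)" using elim(5) by (simp add: mult_ac)
    also have "\<dots> \<le> real (?k n) * real (heavy_margin n)"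
      using elim(1) by (intro mult_left_mono) auto
    finally have b_le: "2 * b n \<le> ?k n * heavy_margin n"
      by (simp only: of_nat_mult[symmetric] of_nat_le_iff)
    have "real (b n) * (1 - real (b n) * pairs_bound n * (1 / g) ^ b n) \<le> mean_heavy n"
    proof (rule mean_heavy_sum_lower)
      fix s assume s: "s < 2 * b n"
      let ?F = "\<lambda>s. real (block_count (?k n) n (heavy_margin n) (light_margin n) s)"
      have "g * ?F s \<le> (L * ((real (heavy_margin n) - e * real n) / (real (heavy_margin n) - e * real n + real n)) ^ 2 *
         (1 + (real n ^ 2 - 1) / (real (n * light_margin n) + 1))) * ?F s"
        using elim(1) by (intro mult_right_mono) auto
      also have "\<dots> \<le> ?F (s + 1)"
        by (rule block_count_growth[OF _ _ _ s elim(5) _ L elim(6)]) (use elim in auto)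
      finally show "g * ?F s \<le> ?F (s + 1)" .
    qed (use elim b_le g in auto)
    moreover have "real (b n) * pairs_bound n * (1 / g) ^ b n \<le> 1 / 2"
    proof -
      have "e * real (?k n) * real n \<le> e * real n * real n"
        using elim(8) e by (intro mult_mono) auto
      moreover have "e * real n * real n = e * real n ^ 2" by (simp add: power2_eq_square)
      moreover have "real (b n) \<le> real (2 * b n)" by simp
      ultimately have "real (b n) \<le> real n ^ 6"
        using elim(4,5) by linarith
      then have "real (b n) * pairs_bound n * (1 / g) ^ b n \<le> real n ^ 6 * pairs_bound n * (1 / g) ^ b n"
        using g by (intro mult_right_mono) (auto simp: margin_pairs_bound_def)
      then show ?thesis using elim(2) by linarith
    qed
    then have "real (b n) * (1 / 2) \<le> real (b n) * (1 - real (b n) * pairs_bound n * (1 / g) ^ b n)"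
      by (intro mult_left_mono) auto
    ultimately show ?case by linarith
  qed
qed


text \<open>For \<open>s\<close> up to \<open>2 * k\<^sup>2 / D\<close> the factor \<open>1 + k\<^sup>2 / s\<close> exceeds \<open>D / 2\<close>, which for large \<open>D\<close>
  makes the quotient larger than 1, since the other two factors stay bounded away from 0.\<close>

lemma mean_lower_quadratic:
  "\<exists>c>0. \<forall>\<^sub>F n in sequentially. c * real (num_heavy \<delta> n) ^ 2 \<le> mean_heavy n"
proof -
  let ?k = "\<lambda>n. num_heavy \<delta> n"
  define e where "e = B * C / 2"
  have e: "0 < e" "e < B * C" using BC by (auto simp: e_def)
  define p where "p = ((B * C - e) / (B * C - e + 1)) ^ 2 * (1 + 1 / C)"
  have p: "p > 0" using e C unfolding p_def by (intro mult_pos_pos) (auto simp: add_pos_pos)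
  \<comment> \<open>The quotient in the range up to \<open>2 * k\<^sup>2 / D\<close> is asymptotically at least \<open>(D / 2) * p\<close>.\<close>
  define D where "D = nat \<lceil>2 / p\<rceil> + 1"
  have D: "D > 0" "2 / p < real D" by (auto simp: D_def) linarith
  let ?b = "\<lambda>n. ?k n ^ 2 div D"
  have b_up: "real D * real (?b n) \<le> real (?k n) ^ 2" for n
    using times_div_less_eq_dividend[of D "?k n ^ 2"]
    by (metis of_nat_le_iff of_nat_mult of_nat_power)
  have b_low: "\<forall>\<^sub>F n in sequentially. real (?k n) ^ 2 / (2 * real D) \<le> real (?b n)"
  proof -
    have "\<forall>\<^sub>F n in sequentially. 2 * real D \<le> real (?k n)"
      using num_heavy_at_top unfolding filterlim_at_top by blast
    then show ?thesis
    proof eventually_elim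
      case (elim n)
      have "real (?k n) * 1 \<le> real (?k n) * real (?k n)" using elim D by (intro mult_left_mono) auto
      then have kk: "2 * real D \<le> real (?k n) ^ 2" using elim by (simp add: power2_eq_square)
      have "?k n ^ 2 \<le> D * ?b n + D"
        using mult_div_mod_eq[of D "?k n ^ 2"] mod_less_divisor[OF D(1), of "?k n ^ 2"] by linarith
      then have "real (?k n ^ 2) \<le> real (D * ?b n + D)" by (rule of_nat_mono)
      then have "real (?k n) ^ 2 / 2 \<le> real D * real (?b n)" using kk by simp
      then show ?case using D by (simp add: field_simps)
    qed
  qed
  have "\<forall>\<^sub>F n in sequentially. real (?b n) / 2 \<le> mean_heavy n"
  proof (rule mean_lower[OF e, of "real D / 2" "1 / (8 * real D)"])
    show "1 < real D / 2 * ((B * C - e) / (B * C - e + 1)) ^ 2 * (1 + 1 / C)"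
      using D p unfolding mult.assoc p_def[symmetric] by (simp add: field_simps)
    show "\<forall>\<^sub>F n in sequentially. 1 / (8 * real D) * real n powr (2 * \<delta>) \<le> real (?b n)"
      using b_low num_heavy_ge
    proof eventually_elim
      case (elim n)
      have "(real n powr \<delta> / 2) ^ 2 \<le> real (?k n) ^ 2" using elim by (intro power_mono) auto
      then have "real n powr (2 * \<delta>) / 4 \<le> real (?k n) ^ 2"
        by (simp add: power2_eq_square powr_add[symmetric])
      then have "real n powr (2 * \<delta>) / 4 / (2 * real D) \<le> real (?k n) ^ 2 / (2 * real D)"
        using D by (intro divide_right_mono) auto
      then show ?case using elim(1) by simp
    qed
    show "\<forall>\<^sub>F n in sequentially. real (2 * ?b n) \<le> e * real (?k n) * real n"
      using num_heavy_eventually_le[OF half_gt_zero[OF e(1)]]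
    proof eventually_elim
      case (elim n)
      have "real (?b n) \<le> real D * real (?b n)" using D mult_right_mono[of 1 "real D" "real (?b n)"] by simp
      then have "real (2 * ?b n) \<le> 2 * (real (?k n) * real (?k n))"
        using b_up[of n] by (simp add: power2_eq_square)
      also have "\<dots> \<le> 2 * (real (?k n) * (e / 2 * real n))"
        using elim by (intro mult_left_mono) auto
      finally show ?case by (simp add: mult_ac)
    qed
    have "\<forall>\<^sub>F n in sequentially. 1 \<le> real (?k n)"
      using num_heavy_at_top unfolding filterlim_at_top by blast
    with b_low show "\<forall>\<^sub>F n in sequentially. real D / 2 \<le> max 1 (real (?k n) ^ 2 / real (2 * ?b n))"
    proof eventually_elim
      case (elim n)
      have "0 < real (?k n) ^ 2 / (2 * real D)" using elim D by simp
      then have "0 < real (?b n)" using elim by linarith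
      then have "real D / 2 \<le> real (?k n) ^ 2 / real (2 * ?b n)"
        using b_up[of n] by (simp add: field_simps)
      then show ?case by simp
    qed
  qed (use D in auto)
  with b_low have "\<forall>\<^sub>F n in sequentially. 1 / (4 * real D) * real (?k n) ^ 2 \<le> mean_heavy n"
    by eventually_elim simp
  then show ?thesis using D by (intro exI[of _ "1 / (4 * real D)"]) auto
qed

text \<open>By continuity the limiting quotient stays above 1 if the mean \<open>B * C\<close> of the heavy-by-light
  entries drops by a small \<open>e\<close>, hence for all \<open>s\<close> up to \<open>e * k * n\<close>, without help from the
  factor \<open>1 + k\<^sup>2 / s\<close>.\<close>

lemma mean_supercritical_lower:
  assumes "B > critical_B C"
  shows "\<exists>c>0. \<forall>\<^sub>F n in sequentially. c * real (num_heavy \<delta> n) * real n \<le> mean_heavy n"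
proof -
  let ?k = "\<lambda>n. num_heavy \<delta> n"
  have "((\<lambda>e. ((B * C - e) / (B * C - e + 1)) ^ 2 * (1 + 1 / C)) \<longlongrightarrow>
      ((B * C - 0) / (B * C - 0 + 1)) ^ 2 * (1 + 1 / C)) (at_right 0)"
    using BC by (intro tendsto_intros) auto
  then have "\<forall>\<^sub>F e in at_right 0. ((B * C - e) / (B * C - e + 1)) ^ 2 * (1 + 1 / C) > 1"
    using supercritical_ratio[OF C assms] by (intro order_tendstoD(1)) auto
  moreover have "\<forall>\<^sub>F e in at_right 0. e < B * C \<and> e > 0"
    using eventually_at_right_field[of _ 0] BC by auto
  ultimately have "\<forall>\<^sub>F e in at_right 0.
      (((B * C - e) / (B * C - e + 1)) ^ 2 * (1 + 1 / C) > 1) \<and> e < B * C \<and> e > 0"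
    by eventually_elim auto
  then obtain e where e: "0 < e" "e < B * C"
    and e1: "((B * C - e) / (B * C - e + 1)) ^ 2 * (1 + 1 / C) > 1"
    using eventually_happens'[OF trivial_limit_at_right_real] by blast
  define b where "b = (\<lambda>n. nat \<lfloor>e * real (?k n) * real n / 2\<rfloor>)"
  have b: "real (b n) \<le> e * real (?k n) * real n / 2" "e * real (?k n) * real n / 2 - 1 \<le> real (b n)" for n
    unfolding b_def using e by (intro nat_floor_bounds; simp)+
  have b_low: "\<forall>\<^sub>F n in sequentially. e / 4 * real (?k n) * real n \<le> real (b n)"
  proof -
    have "\<forall>\<^sub>F n in sequentially. 4 / e \<le> real (?k n)"
      using num_heavy_at_top unfolding filterlim_at_top by blast
    then show ?thesis using eventually_gt_at_top[of 0]
    proof eventually_elim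
      case (elim n)
      have "4 / e * 1 \<le> real (?k n) * real n" using elim e by (intro mult_mono) auto
      then have "4 \<le> e * real (?k n) * real n" using e by (simp add: field_simps)
      then show ?case using b(2)[of n] by linarith
    qed
  qed
  have "\<forall>\<^sub>F n in sequentially. real (b n) / 2 \<le> mean_heavy n"
  proof (rule mean_lower[OF e, of 1 "e / 8"])
    show "\<forall>\<^sub>F n in sequentially. e / 8 * real n powr (2 * \<delta>) \<le> real (b n)"
      using b_low num_heavy_ge eventually_gt_at_top[of 0]
    proof eventually_elim
      case (elim n)
      have "real n powr (2 * \<delta>) = real n powr \<delta> * real n powr \<delta>"
        by (simp flip: powr_add)
      also have "\<dots> \<le> (2 * real (?k n)) * real n powr 1"
        using elim \<delta> by (intro mult_mono powr_mono) auto
      finally have "e / 8 * real n powr (2 * \<delta>) \<le> e / 8 * ((2 * real (?k n)) * real n powr 1)"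
        using e by (intro mult_left_mono) auto
      also have "\<dots> = e / 4 * real (?k n) * real n" by simp
      finally show ?case using elim(1) by linarith
    qed
    show "\<forall>\<^sub>F n in sequentially. real (2 * b n) \<le> e * real (?k n) * real n"
      using b(1) by (intro always_eventually allI) (simp add: field_simps)
  qed (use e e1 in auto)
  with b_low have "\<forall>\<^sub>F n in sequentially. e / 8 * real (?k n) * real n \<le> mean_heavy n"
    by eventually_elim simp
  then show ?thesis using e by (intro exI[of _ "e / 8"]) auto
qed

text \<open>The upper bound above the critical value: the heavy rows have total \<open>k * u\<close>.\<close>

lemma mean_heavy_trivial:
  "mean_heavy n \<le> real (num_heavy \<delta> n) * real (heavy_margin n)"
proof -
  let ?T = "split_tables (num_heavy \<delta> n) n (heavy_margin n) (light_margin n)"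
  have "(\<Sum>X\<in>?T. real (heavy_sum (num_heavy \<delta> n) X)) \<le>
      (\<Sum>X\<in>?T. real (num_heavy \<delta> n * heavy_margin n))"
    by (intro sum_mono of_nat_mono heavy_sum_le)
  then show ?thesis
    unfolding mean_heavy_sum_def
    using card_split_tables_pos[of "num_heavy \<delta> n" n "heavy_margin n" "light_margin n"]
    by (subst pos_divide_le_eq) (auto simp: mult.commute)
qed

abbreviation "corner_mean n \<equiv> measure_pmf.expectation (uniform_table B C \<delta> n) (\<lambda>X. real (X 1 1))"

lemma corner_mean:
  "\<forall>\<^sub>F n in sequentially. real (num_heavy \<delta> n) > 0 \<and>
     corner_mean n = mean_heavy n / real (num_heavy \<delta> n) ^ 2"
proof -
  have "\<forall>\<^sub>F n in sequentially. 1 \<le> real (num_heavy \<delta> n)"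
    using num_heavy_at_top unfolding filterlim_at_top by blast
  then show ?thesis
    by eventually_elim (use expectation_corner[of \<delta> _ B C] in \<open>auto simp: heavy_margin_def light_margin_def\<close>)
qed

lemma corner_mean_subcritical:
  assumes "B < critical_B C"
  shows "corner_mean \<in> \<Theta>(\<lambda>n. 1)"
proof (rule bigthetaI)
  obtain c where "\<forall>\<^sub>F n in sequentially. mean_heavy n \<le> c * real (num_heavy \<delta> n) ^ 2"
    using mean_upper[OF assms] by blast
  with corner_mean have "\<forall>\<^sub>F n in sequentially. norm (corner_mean n) \<le> c * norm (1 :: real)"
  proof eventually_elim
    case (elim n)
    then have "corner_mean n \<le> c" by (simp add: pos_divide_le_eq)
    then show ?case by (simp add: integral_nonneg)
  qed
  then show "corner_mean \<in> O(\<lambda>n. 1)" by (rule bigoI)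
  obtain c where c: "c > 0" "\<forall>\<^sub>F n in sequentially. c * real (num_heavy \<delta> n) ^ 2 \<le> mean_heavy n"
    using mean_lower_quadratic by blast
  from corner_mean c(2) have "\<forall>\<^sub>F n in sequentially. norm (1 :: real) \<le> 1 / c * norm (corner_mean n)"
  proof eventually_elim
    case (elim n)
    then have "c \<le> corner_mean n" by (simp add: field_simps)
    then show ?case using c(1) by (simp add: field_simps)
  qed
  then show "corner_mean \<in> \<Omega>(\<lambda>n. 1)" unfolding bigomega_iff_bigo by (rule bigoI)
qed

lemma corner_mean_supercritical:
  assumes "B > critical_B C"
  shows "corner_mean \<in> \<Theta>(\<lambda>n. real n powr (1 - \<delta>))"
proof (rule bigthetaI)
  from corner_mean num_heavy_ge eventually_gt_at_top[of 0]
  have "\<forall>\<^sub>F n in sequentially. norm (corner_mean n) \<le> (2 * B * C) * norm (real n powr (1 - \<delta>))"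
  proof eventually_elim
    case (elim n)
    have nd: "real n powr \<delta> > 0" using elim by simp
    have "corner_mean n \<le> real (num_heavy \<delta> n) * real (heavy_margin n) / real (num_heavy \<delta> n) ^ 2"
      using elim mean_heavy_trivial[of n] by (auto intro: divide_right_mono)
    also have "\<dots> = real (heavy_margin n) / real (num_heavy \<delta> n)"
      using elim by (simp add: power2_eq_square)
    also have "\<dots> \<le> (B * C * real n) / (real n powr \<delta> / 2)"
      using elim heavy_margin_bounds(1)[of n] nd B C by (intro frac_le) auto
    also have "\<dots> = (2 * B * C) * real n powr (1 - \<delta>)"
      using elim by (simp add: powr_diff)
    finally show ?case by (simp add: integral_nonneg)
  qed
  then show "corner_mean \<in> O(\<lambda>n. real n powr (1 - \<delta>))" by (rule bigoI)
  obtain c where c: "c > 0"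
    "\<forall>\<^sub>F n in sequentially. c * real (num_heavy \<delta> n) * real n \<le> mean_heavy n"
    using mean_supercritical_lower[OF assms] by blast
  from corner_mean c(2) eventually_gt_at_top[of 0]
  have "\<forall>\<^sub>F n in sequentially. norm (real n powr (1 - \<delta>)) \<le> 1 / c * norm (corner_mean n)"
  proof eventually_elim
    case (elim n)
    let ?k = "real (num_heavy \<delta> n)"
    have "real n powr (1 - \<delta>) = real n / real n powr \<delta>"
      using elim by (simp add: powr_diff)
    also have "\<dots> \<le> real n / ?k"
      using elim num_heavy_le[of \<delta> n] by (intro divide_left_mono) auto
    finally have "c * real n powr (1 - \<delta>) \<le> c * (real n / ?k)"
      using c(1) by (intro mult_left_mono) auto
    also have "\<dots> = (c * ?k * real n) / ?k ^ 2" using elim by (simp add: power2_eq_square)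
    also have "\<dots> \<le> corner_mean n"
      using elim by (auto intro: divide_right_mono)
    finally show ?case using c(1) by (simp add: field_simps)
  qed
  then show "corner_mean \<in> \<Omega>(\<lambda>n. real n powr (1 - \<delta>))" unfolding bigomega_iff_bigo by (rule bigoI)
qed

end

theorem corollary1p1:
  fixes B C \<delta> :: real
  assumes "B > 0" and "C > 0" and "1 / 2 < \<delta>" and "\<delta> < 1"
  shows "(B < critical_B C \<longrightarrow>
            (\<lambda>n. measure_pmf.expectation (uniform_table B C \<delta> n) (\<lambda>X. real (X 1 1)))
              \<in> \<Theta>(\<lambda>n. 1)) \<and>
         (B > critical_B C \<longrightarrow>
            (\<lambda>n. measure_pmf.expectation (uniform_table B C \<delta> n) (\<lambda>X. real (X 1 1)))
              \<in> \<Theta>(\<lambda>n. real n powr (1 - \<delta>)))"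
  using corner_mean_subcritical[OF assms] corner_mean_supercritical[OF assms] by blast

end
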